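(* Let $K:\mathcal{X}^2\to\mathbb{R}$ be the kernel of a reproducing kernel Hilbert space $\mathcal{H}$ of functions from $\mathcal{X}$ to $\mathbb{R}$, let $X,Y$ be random variables valued in the separable Hilbert spaces $\mathcal{X},\mathcal{Y}$ with $\mathbb{E}(\Vert Y\Vert_{\mathcal{Y}}^2)<+\infty$, let $\{(X_i,Y_i)\}_{1\le i\le n}$ be an i.i.d. sample of $(X,Y)$, and let $\{w_{i,n}(\gamma)\}_{1\le i\le n}$ be a triangular array of positive real numbers depending on a parameter $\gamma\in\,]0,1[$. Assume: (1) $\Vert K\Vert_\infty:=\sup_{(x,y)\in\mathcal{X}^2}K(x,y)<+\infty$; (2) there exist a real number $\tau>0$ and an integer $n_0$ such that for all $n>n_0$, $n\left|\frac1n\sum_{i=1}^n w_{i,n}(\gamma)-1\right|\le\tau$; (3) there exists $C>0$ such that $\max_{1\le i\le n}w_{i,n}(\gamma)<C$ for all $n\in\mathbb{N}^*$ and all $\gamma\in\,]0,1[$; (4) for any $\gamma\in\,]0,1[$, $\lim_{n\to+\infty}\frac1n\sum_{i=1}^n w_{i,n}^2(\gamma)=w^2(\gamma)>1$. Then, as $n\to+\infty$, $$\sqrt{n}\left(\widehat{K}_{n,\gamma}-\mathrm{KCMD}(Y,X)\right)\longrightarrow\mathcal{N}(0,\sigma_\gamma^2)\quad\text{in distribution},$$ where $$\sigma_\gamma^2=4\,\mathrm{Var}\left(\mathcal{U}(X_1,Y_1)\right)+4\,w^2(\gamma)\,\mathrm{Var}\left(\mathcal{V}(X_1,Y_1)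\right)-8\,\mathrm{Cov}\left(\mathcal{U}(X_1,Y_1),\mathcal{V}(X_1,Y_1)\right).$$
   Context: $X$ and $Y$ are random variables on a probability space $(\Omega,\mathscr{A},P)$ valued in separable (real) Hilbert spaces $\mathcal{X}$ and $\mathcal{Y}$, with $\mathbb{E}(\Vert Y\Vert_{\mathcal{Y}}^2)<+\infty$. The kernel $K:\mathcal{X}^2\to\mathbb{R}$ is symmetric, with $K(x,\cdot)\in\mathcal{H}$ and $f(x)=\langle K(x,\cdot),f\rangle_{\mathcal{H}}$ for all $x\in\mathcal{X}$, $f\in\mathcal{H}$. Since $\Vert K\Vert_\infty<+\infty$, the kernel mean embedding $m_X:=\mathbb{E}(K(X,\cdot))\in\mathcal{H}$ exists. For $(y,f)\in\mathcal{Y}\times\mathcal{H}$, $y\otimes f$ is the linear operator $t\in\mathcal{Y}\mapsto\langle y,t\rangle_{\mathcal{Y}}f\in\mathcal{H}$; $\Vert\cdot\Vert_{\mathrm{HS}}$ and $\langle\cdot,\cdot\rangle_{\mathrm{HS}}$ are the Hilbert-Schmidt norm and inner product of operators. Put $\mu=\mathbb{E}(Y)$, $\eta=\mathbb{E}(Y\otimes K(X,\cdot))$, $\nu=\mu\otimes m_X$. The kernel-based conditional mean dependence measure is $$\mathrm{KCMD}(Y,X)=\left\Vert\mathbb{E}\left(Y\otimes K(X,\cdot)\right)-\mu\otimes m_X\right\Vert_{\mathrm{HS}}^2=\Vert\eta-\nu\Vert_{\mathrm{HS}}^2 .$$ The estimator $\widehat{K}_{n,\gamma}$ is $$\widehat{K}_{n,\gamma}=\frac{1}{n^2}\sum_{i,j=1}^n\langle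 Y_i,Y_j\rangle_{\mathcal{Y}}K(X_i,X_j)+\frac{1}{n^4}\sum_{i,j,q,r=1}^n\langle Y_q,Y_r\rangle_{\mathcal{Y}}K(X_i,X_j)-\frac{2}{n^3}\sum_{i,j,q=1}^n w_{i,n}(\gamma)\langle Y_i,Y_q\rangle_{\mathcal{Y}}K(X_i,X_j).$$ The functions $\mathcal{U},\mathcal{V}:\mathcal{X}\times\mathcal{Y}\to\mathbb{R}$ are $$\mathcal{U}(x,y)=\langle y\otimes K(x,\cdot)-\eta,\eta\rangle_{\mathrm{HS}}+\langle y\otimes m_X+\mu\otimes K(x,\cdot)-2\nu,\nu-\eta\rangle_{\mathrm{HS}},$$ $$\mathcal{V}(x,y)=\langle y\otimes K(x,\cdot)-\eta,\nu\rangle_{\mathrm{HS}}.$$ *)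

theory Defs
  imports "HOL-Probability.Probability"
begin

section \<open>Hilbert-Schmidt operators\<close>

definition is_orthonormal_basis :: "'a::real_inner set \<Rightarrow> bool" where
  "is_orthonormal_basis B \<longleftrightarrow>
     pairwise orthogonal B \<and> (\<forall>e\<in>B. norm e = 1) \<and> closure (span B) = UNIV"

lemma finite_orthonormal_extend:
  fixes F :: "'a::real_inner set"
  assumes "finite F" "pairwise orthogonal F" "\<forall>e\<in>F. norm e = 1"
  shows "\<exists>F'. finite F' \<and> pairwise orthogonal F' \<and> (\<forall>e\<in>F'. norm e = 1) \<and> F \<subseteq> F' \<and> x \<in> span F'"
proof -
  define r where "r = x - (\<Sum>e\<in>F. (x \<bullet> e) *\<^sub>R e)"
  have p: "(\<Sum>e\<in>F. (x \<bullet> e) *\<^sub>R e) \<in> span F"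
    by (intro span_sum span_scale span_base)
  have orth: "r \<bullet> g = 0" if "g \<in> F" for g
  proof -
    have "(\<Sum>e\<in>F. (x \<bullet> e) *\<^sub>R e) \<bullet> g = (\<Sum>e\<in>F. if e = g then x \<bullet> e else 0)"
      unfolding inner_sum_left using assms that
      by (intro sum.cong) (auto simp: pairwise_def orthogonal_def norm_eq_1)
    also have "\<dots> = x \<bullet> g" using assms(1) that by simp
    finally show ?thesis by (simp add: r_def inner_diff_left)
  qed
  show ?thesis
  proof (cases "r = 0")
    case True
    then have "x \<in> span F" using p by (simp add: r_def)
    then show ?thesis using assms by blast
  next
    case False
    let ?F = "insert (r /\<^sub>R norm r) F"
    have "x = norm r *\<^sub>R (r /\<^sub>R norm r) + (\<Sum>e\<in>F. (x \<bullet> e) *\<^sub>R e)"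
      using False by (simp add: r_def)
    moreover have "(\<Sum>e\<in>F. (x \<bullet> e) *\<^sub>R e) \<in> span ?F"
      using p span_mono[of F ?F] by blast
    moreover have "norm r *\<^sub>R (r /\<^sub>R norm r) \<in> span ?F"
      by (intro span_scale span_base) simp
    ultimately have "x \<in> span ?F"
      by (metis span_add)
    moreover have "pairwise orthogonal ?F"
      using assms(2) orth by (auto simp: pairwise_insert orthogonal_def inner_commute)
    moreover have "\<forall>e\<in>?F. norm e = 1" using assms(3) False by simp
    ultimately show ?thesis using assms(1) by (intro exI[of _ ?F]) auto
  qed
qed

lemma ex_orthonormal_basis:
  "\<exists>B :: 'a::{real_inner,second_countable_topology} set. is_orthonormal_basis B"
proof -
  obtain D :: "'a set" where D: "countable D" "\<And>X. open X \<Longrightarrow> X \<noteq> {} \<Longrightarrow> \<exists>d\<in>D. d \<in> X"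
    using countable_dense_setE by metis
  have Dne: "D \<noteq> {}" using D(2)[of UNIV] by auto
  define P :: "nat \<Rightarrow> 'a set \<Rightarrow> bool" where
    "P = (\<lambda>n F. finite F \<and> pairwise orthogonal F \<and> (\<forall>e\<in>F. norm e = 1))"
  have "\<exists>F. \<forall>n. P n (F n) \<and> F n \<subseteq> F (Suc n) \<and> from_nat_into D n \<in> span (F (Suc n))"
  proof (rule dependent_nat_choice)
    show "\<exists>x. P 0 x" by (intro exI[of _ "{}"]) (simp add: P_def)
    fix F n assume "P n F"
    then show "\<exists>F'. P (Suc n) F' \<and> F \<subseteq> F' \<and> from_nat_into D n \<in> span F'"
      using finite_orthonormal_extend[of F "from_nat_into D n"] unfolding P_def by metis
  qed
  then obtain F where F: "\<And>n. P n (F n)" "\<And>n. F n \<subseteq> F (Suc n)"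
      "\<And>n. from_nat_into D n \<in> span (F (Suc n))" by blast
  have mono: "F m \<subseteq> F n" if "m \<le> n" for m n
    using lift_Suc_mono_le[of F, OF F(2) that] .
  define B where "B = (\<Union>n. F n)"
  have "pairwise orthogonal B"
    unfolding pairwise_def
  proof (intro ballI impI)
    fix x y assume "x \<in> B" "y \<in> B" "x \<noteq> y"
    then obtain m n where "x \<in> F m" "y \<in> F n" unfolding B_def by auto
    then have "x \<in> F (max m n)" "y \<in> F (max m n)"
      using mono[of m "max m n"] mono[of n "max m n"] by auto
    then show "orthogonal x y"
      using F(1)[of "max m n"] \<open>x \<noteq> y\<close> unfolding P_def pairwise_def by blast
  qed
  moreover have "\<forall>e\<in>B. norm e = 1" using F(1) unfolding B_def P_def by blast
  moreover have "closure (span B) = UNIV"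
  proof -
    have sub: "D \<subseteq> span B"
    proof
      fix d assume "d \<in> D"
      then obtain n where "d = from_nat_into D n"
        using from_nat_into_surj[OF D(1)] by metis
      then have "d \<in> span (F (Suc n))" using F(3) by simp
      moreover have "F (Suc n) \<subseteq> B" unfolding B_def by blast
      ultimately show "d \<in> span B" using span_mono by blast
    qed
    have "x \<in> closure D" for x
      unfolding closure_iff_nhds_not_empty
      using D(2) by (metis disjoint_iff empty_iff interior_subset open_interior subsetD)
    then show ?thesis using closure_mono[OF sub] by auto
  qed
  ultimately show ?thesis unfolding is_orthonormal_basis_def by blast
qed

text \<open>
  Sorts in use: a real Hilbert space has sort \<open>{real_inner, banach}\<close>, a separable one
  \<open>{real_inner, banach, second_countable_topology}\<close>.
\<close>

definition onb :: "'a::{real_inner,second_countable_topology} set" where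
  "onb = (SOME B. is_orthonormal_basis B)"

lemma is_orthonormal_basis_onb: "is_orthonormal_basis onb"
  unfolding onb_def by (rule someI_ex) (rule ex_orthonormal_basis)

lemma onb_orthogonal: "e \<in> onb \<Longrightarrow> e' \<in> onb \<Longrightarrow> e \<noteq> e' \<Longrightarrow> e \<bullet> e' = 0"
  and onb_norm: "e \<in> onb \<Longrightarrow> norm e = 1"
  and closure_span_onb: "closure (span onb) = UNIV"
  using is_orthonormal_basis_onb
  by (auto simp: is_orthonormal_basis_def pairwise_def orthogonal_def)

lemma onb_bessel:
  assumes "finite F" "F \<subseteq> onb"
  shows "(\<Sum>e\<in>F. (y \<bullet> e)\<^sup>2) \<le> (norm y)\<^sup>2"
proof -
  let ?p = "\<Sum>e\<in>F. (y \<bullet> e) *\<^sub>R e"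
  have 1: "y \<bullet> ?p = (\<Sum>e\<in>F. (y \<bullet> e)\<^sup>2)"
    by (simp add: inner_sum_right power2_eq_square)
  have "?p \<bullet> e' = y \<bullet> e'" if "e' \<in> F" for e'
  proof -
    have "?p \<bullet> e' = (\<Sum>e\<in>F. if e = e' then y \<bullet> e else 0)"
      unfolding inner_sum_left using assms that
      by (intro sum.cong) (auto simp: onb_orthogonal onb_norm norm_eq_1[symmetric] subset_iff)
    then show ?thesis using assms(1) that by simp
  qed
  moreover have "?p \<bullet> ?p = (\<Sum>e\<in>F. (y \<bullet> e) * (?p \<bullet> e))"
    by (rule trans[OF inner_sum_right]) simp
  ultimately have 2: "?p \<bullet> ?p = (\<Sum>e\<in>F. (y \<bullet> e)\<^sup>2)"
    by (simp add: power2_eq_square)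
  have "0 \<le> (y - ?p) \<bullet> (y - ?p)" by simp
  also have "\<dots> = (norm y)\<^sup>2 - (\<Sum>e\<in>F. (y \<bullet> e)\<^sup>2)"
    using 1 2 by (simp add: inner_diff_left inner_diff_right inner_commute power2_norm_eq_inner)
  finally show ?thesis by simp
qed

text \<open>
  The Hilbert-Schmidt condition, inner product and norm are computed in one fixed orthonormal
  basis of the domain; by Parseval's identity they do not depend on that choice.
\<close>

typedef (overloaded) ('a, 'b) hs =
  "{A :: 'a::{real_inner,second_countable_topology} \<Rightarrow>\<^sub>L 'b::real_inner.
     (\<lambda>e. (norm (blinfun_apply A e))\<^sup>2) summable_on onb}"
  morphisms hs_op Abs_hs
  by (rule exI[of _ 0]) simp

setup_lifting type_definition_hs

lemma hs_summable: "(\<lambda>e. (norm (blinfun_apply (hs_op A) e))\<^sup>2) summable_on onb"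
  using hs_op[of A] by simp

lemma hs_summable_inner:
  "(\<lambda>e. blinfun_apply (hs_op A) e \<bullet> blinfun_apply (hs_op B) e) summable_on onb"
proof (rule Infinite_Sum.abs_summable_summable, rule Infinite_Sum.abs_summable_on_comparison_test')
  show "(\<lambda>e. (norm (blinfun_apply (hs_op A) e))\<^sup>2 + (norm (blinfun_apply (hs_op B) e))\<^sup>2) summable_on onb"
    by (intro summable_on_add hs_summable)
  fix e
  let ?a = "norm (blinfun_apply (hs_op A) e)" and ?b = "norm (blinfun_apply (hs_op B) e)"
  have "norm (blinfun_apply (hs_op A) e \<bullet> blinfun_apply (hs_op B) e) \<le> ?a * ?b"
    by (simp add: Cauchy_Schwarz_ineq2)
  also have "\<dots> \<le> ?a\<^sup>2 + ?b\<^sup>2"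
  proof -
    have "0 \<le> (?a - ?b)\<^sup>2 + ?a\<^sup>2 + ?b\<^sup>2" by simp
    then show ?thesis unfolding power2_diff by simp
  qed
  finally show "norm (blinfun_apply (hs_op A) e \<bullet> blinfun_apply (hs_op B) e) \<le> ?a\<^sup>2 + ?b\<^sup>2" .
qed

lemma summable_on_add_sq:
  fixes f g :: "'a \<Rightarrow> 'b::real_inner"
  assumes "(\<lambda>e. (norm (f e))\<^sup>2) summable_on S" "(\<lambda>e. (norm (g e))\<^sup>2) summable_on S"
  shows "(\<lambda>e. (norm (f e + g e))\<^sup>2) summable_on S"
proof (rule summable_on_comparison_test)
  show "(\<lambda>e. 2 * (norm (f e))\<^sup>2 + 2 * (norm (g e))\<^sup>2) summable_on S"
    by (intro summable_on_add summable_on_cmult_right assms)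
  fix e
  have "(norm (f e + g e))\<^sup>2 \<le> (norm (f e) + norm (g e))\<^sup>2"
    by (intro power_mono norm_triangle_ineq) simp
  also have "\<dots> \<le> 2 * (norm (f e))\<^sup>2 + 2 * (norm (g e))\<^sup>2"
  proof -
    have "0 \<le> (norm (f e) - norm (g e))\<^sup>2" by simp
    then show ?thesis unfolding power2_diff power2_sum by simp
  qed
  finally show "(norm (f e + g e))\<^sup>2 \<le> 2 * (norm (f e))\<^sup>2 + 2 * (norm (g e))\<^sup>2" .
qed simp

instantiation hs :: ("{real_inner,second_countable_topology}", real_inner) real_inner
begin

lift_definition zero_hs :: "('a, 'b) hs" is 0 by simp

lift_definition plus_hs :: "('a, 'b) hs \<Rightarrow> ('a, 'b) hs \<Rightarrow> ('a, 'b) hs" is "(+)"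
  by (simp add: blinfun.add_left summable_on_add_sq)

lift_definition scaleR_hs :: "real \<Rightarrow> ('a, 'b) hs \<Rightarrow> ('a, 'b) hs" is "(*\<^sub>R)"
  by (simp add: blinfun.scaleR_left power_mult_distrib summable_on_cmult_right)

lift_definition uminus_hs :: "('a, 'b) hs \<Rightarrow> ('a, 'b) hs" is uminus
  by (simp add: blinfun.minus_left)

definition minus_hs :: "('a, 'b) hs \<Rightarrow> ('a, 'b) hs \<Rightarrow> ('a, 'b) hs" where
  "minus_hs A B = A + - B"

definition inner_hs :: "('a, 'b) hs \<Rightarrow> ('a, 'b) hs \<Rightarrow> real" where
  "inner_hs A B = (\<Sum>\<^sub>\<infinity>e\<in>onb. blinfun_apply (hs_op A) e \<bullet> blinfun_apply (hs_op B) e)"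

definition norm_hs :: "('a, 'b) hs \<Rightarrow> real" where
  "norm_hs A = sqrt (inner A A)"

definition sgn_hs :: "('a, 'b) hs \<Rightarrow> ('a, 'b) hs" where
  "sgn_hs A = inverse (norm A) *\<^sub>R A"

definition dist_hs :: "('a, 'b) hs \<Rightarrow> ('a, 'b) hs \<Rightarrow> real" where
  "dist_hs A B = norm (A - B)"

definition uniformity_hs :: "(('a, 'b) hs \<times> ('a, 'b) hs) filter" where
  "uniformity_hs = (INF e\<in>{0 <..}. principal {(x, y). dist x y < e})"

definition open_hs :: "('a, 'b) hs set \<Rightarrow> bool" where
  "open_hs U \<longleftrightarrow> (\<forall>x\<in>U. eventually (\<lambda>(x', y). x' = x \<longrightarrow> y \<in> U) uniformity)"

instance
proof
  fix A B C :: "('a, 'b) hs" and r s :: real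
  show "A + B + C = A + (B + C)" by transfer (simp add: algebra_simps)
  show "A + B = B + A" by transfer (simp add: algebra_simps)
  show "0 + A = A" by transfer simp
  show "- A + A = 0" by transfer simp
  show "A - B = A + - B" by (simp add: minus_hs_def)
  show "r *\<^sub>R (A + B) = r *\<^sub>R A + r *\<^sub>R B" by transfer (simp add: algebra_simps)
  show "(r + s) *\<^sub>R A = r *\<^sub>R A + s *\<^sub>R A" by transfer (simp add: algebra_simps)
  show "r *\<^sub>R s *\<^sub>R A = (r * s) *\<^sub>R A" by transfer simp
  show "1 *\<^sub>R A = A" by transfer simp
  show "dist A B = norm (A - B)" by (simp add: dist_hs_def)
  show "sgn A = inverse (norm A) *\<^sub>R A" by (simp add: sgn_hs_def)
  show "(uniformity :: (('a, 'b) hs \<times> ('a, 'b) hs) filter)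
      = (INF e\<in>{0 <..}. principal {(x, y). dist x y < e})"
    by (simp add: uniformity_hs_def)
  show "open U \<longleftrightarrow> (\<forall>x\<in>U. eventually (\<lambda>(x', y). x' = x \<longrightarrow> y \<in> U) uniformity)"
    for U :: "('a, 'b) hs set" by (simp add: open_hs_def)
  show "inner A B = inner B A" by (simp add: inner_hs_def inner_commute)
  show "inner (A + B) C = inner A C + inner B C"
    by (simp add: inner_hs_def plus_hs.rep_eq blinfun.add_left inner_add_left infsum_add hs_summable_inner)
  show "inner (r *\<^sub>R A) B = r * inner A B"
    by (simp add: inner_hs_def scaleR_hs.rep_eq blinfun.scaleR_left infsum_cmult_right hs_summable_inner)
  show "0 \<le> inner A A" by (simp add: inner_hs_def infsum_nonneg)
  show "norm A = sqrt (inner A A)" by (simp add: norm_hs_def)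
  show "inner A A = 0 \<longleftrightarrow> A = 0"
  proof
    assume "inner A A = 0"
    then have z: "blinfun_apply (hs_op A) e = 0" if "e \<in> onb" for e
      using nonneg_infsum_le_0D[of "\<lambda>e. blinfun_apply (hs_op A) e \<bullet> blinfun_apply (hs_op A) e" onb e]
        hs_summable_inner[of A A] that by (simp add: inner_hs_def)
    have sp: "blinfun_apply (hs_op A) x = 0" if "x \<in> span onb" for x
      using that
      by (induction rule: span_induct_alt) (auto simp: blinfun.add_right blinfun.scaleR_right z)
    have "blinfun_apply (hs_op A) x = 0" for x
    proof (rule continuous_constant_on_closure[of "span onb" "blinfun_apply (hs_op A)" 0 x])
      show "continuous_on (closure (span onb)) (blinfun_apply (hs_op A))"
        by (intro continuous_intros)
    qed (use sp closure_span_onb in auto)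
    then have "hs_op A = 0" by (intro blinfun_eqI) simp
    then show "A = 0" by (simp add: hs_op_inject[symmetric] zero_hs.rep_eq)
  next
    assume "A = 0"
    then show "inner A A = 0" by (simp add: inner_hs_def zero_hs.rep_eq)
  qed
qed

end

lemma hs_op_minus: "hs_op (A - B) = hs_op A - hs_op B"
  unfolding minus_hs_def plus_hs.rep_eq uminus_hs.rep_eq by (rule diff_conv_add_uminus[symmetric])

lemma power2_norm_hs: "(norm A)\<^sup>2 = (\<Sum>\<^sub>\<infinity>e\<in>onb. (norm (blinfun_apply (hs_op A) e))\<^sup>2)"
  unfolding power2_norm_eq_inner inner_hs_def ..

lemma norm_hs_op_le: "norm (hs_op A) \<le> norm A"
proof (rule norm_blinfun_bound)
  have sp: "norm (blinfun_apply (hs_op A) x) \<le> norm A * norm x" if xs: "x \<in> span onb" for x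
  proof -
    obtain F c where F: "finite F" "F \<subseteq> onb" and x: "x = (\<Sum>e\<in>F. c e *\<^sub>R e)"
      using xs unfolding span_explicit by blast
    have c: "x \<bullet> e' = c e'" if "e' \<in> F" for e'
    proof -
      have "x \<bullet> e' = (\<Sum>e\<in>F. if e = e' then c e else 0)"
        unfolding x inner_sum_left using F that
        by (intro sum.cong) (auto simp: onb_orthogonal onb_norm norm_eq_1[symmetric] subset_iff)
      then show ?thesis using F(1) that by simp
    qed
    have "norm (blinfun_apply (hs_op A) x) \<le> (\<Sum>e\<in>F. \<bar>c e\<bar> * norm (blinfun_apply (hs_op A) e))"
      unfolding x blinfun.sum_right blinfun.scaleR_right by (intro sum_norm_le) simp
    also have "\<dots> \<le> L2_set c F * L2_set (\<lambda>e. norm (blinfun_apply (hs_op A) e)) F"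
      using L2_set_mult_ineq[where f=c and g="\<lambda>e. norm (blinfun_apply (hs_op A) e)" and A=F] by simp
    also have "\<dots> \<le> norm x * norm A"
    proof (intro mult_mono)
      have "(\<Sum>e\<in>F. (c e)\<^sup>2) \<le> (norm x)\<^sup>2"
        using onb_bessel[OF F, of x] c by simp
      then show "L2_set c F \<le> norm x"
        unfolding L2_set_def by (simp add: real_le_lsqrt sum_nonneg)
      have "(\<Sum>e\<in>F. (norm (blinfun_apply (hs_op A) e))\<^sup>2) \<le> (norm A)\<^sup>2"
        unfolding power2_norm_hs using F by (intro finite_sum_le_infsum hs_summable) auto
      then show "L2_set (\<lambda>e. norm (blinfun_apply (hs_op A) e)) F \<le> norm A"
        unfolding L2_set_def by (simp add: real_le_lsqrt sum_nonneg)
    qed (auto simp: L2_set_nonneg)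
    finally show ?thesis by (simp add: mult.commute)
  qed
  show "norm (blinfun_apply (hs_op A) x) \<le> norm A * norm x" for x
  proof -
    have "closed {x. norm (blinfun_apply (hs_op A) x) \<le> norm A * norm x}"
      by (intro closed_Collect_le continuous_intros)
    then have "closure (span onb) \<subseteq> {x. norm (blinfun_apply (hs_op A) x) \<le> norm A * norm x}"
      using sp by (intro closure_minimal) auto
    then show ?thesis using closure_span_onb by auto
  qed
qed simp

instance hs :: ("{real_inner,second_countable_topology}", "{real_inner,banach}") banach
proof
  fix X :: "nat \<Rightarrow> ('a, 'b) hs"
  assume X: "Cauchy X"
  have "Cauchy (\<lambda>n. hs_op (X n))"
    unfolding Cauchy_iff
  proof (intro allI impI)
    fix e :: real assume "0 < e"
    then obtain N where "\<forall>m\<ge>N. \<forall>n\<ge>N. norm (X m - X n) < e"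
      using X unfolding Cauchy_iff by meson
    then show "\<exists>N. \<forall>m\<ge>N. \<forall>n\<ge>N. norm (hs_op (X m) - hs_op (X n)) < e"
      by (metis hs_op_minus norm_hs_op_le order_le_less_trans)
  qed
  then obtain L where L: "(\<lambda>n. hs_op (X n)) \<longlonglongrightarrow> L"
    using Cauchy_convergent convergent_def by blast
  have bound: "(\<Sum>e\<in>F. (norm (blinfun_apply (hs_op (X m) - L) e))\<^sup>2) \<le> \<epsilon>\<^sup>2"
    if F: "finite F" "F \<subseteq> onb" and N: "\<forall>n\<ge>N. norm (X m - X n) < \<epsilon>" for F m N \<epsilon>
  proof (rule LIMSEQ_le_const2)
    show "(\<lambda>n. \<Sum>e\<in>F. (norm (blinfun_apply (hs_op (X m) - hs_op (X n)) e))\<^sup>2)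
        \<longlonglongrightarrow> (\<Sum>e\<in>F. (norm (blinfun_apply (hs_op (X m) - L) e))\<^sup>2)"
      by (intro tendsto_intros L)
    have "(\<Sum>e\<in>F. (norm (blinfun_apply (hs_op (X m) - hs_op (X n)) e))\<^sup>2) \<le> \<epsilon>\<^sup>2" if "n \<ge> N" for n
    proof -
      have "(\<Sum>e\<in>F. (norm (blinfun_apply (hs_op (X m - X n)) e))\<^sup>2) \<le> (norm (X m - X n))\<^sup>2"
        unfolding power2_norm_hs using F by (intro finite_sum_le_infsum hs_summable) auto
      also have "\<dots> \<le> \<epsilon>\<^sup>2" using N that by (intro power_mono) (auto intro: less_imp_le)
      finally show ?thesis by (simp add: hs_op_minus)
    qed
    then show "\<exists>N. \<forall>n\<ge>N. (\<Sum>e\<in>F. (norm (blinfun_apply (hs_op (X m) - hs_op (X n)) e))\<^sup>2) \<le> \<epsilon>\<^sup>2"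
      by blast
  qed
  have diff: "(\<lambda>e. (norm (blinfun_apply (hs_op (X m) - L) e))\<^sup>2) summable_on onb"
    if N: "\<forall>n\<ge>N. norm (X m - X n) < \<epsilon>" for m N \<epsilon>
  proof (rule nonneg_bdd_above_summable_on)
    show "bdd_above (sum (\<lambda>e. (norm (blinfun_apply (hs_op (X m) - L) e))\<^sup>2) ` {F. F \<subseteq> onb \<and> finite F})"
      using bound[OF _ _ N] by (intro bdd_aboveI[of _ "\<epsilon>\<^sup>2"]) auto
  qed simp
  obtain N1 where N1: "\<forall>m\<ge>N1. \<forall>n\<ge>N1. norm (X m - X n) < 1"
    using X unfolding Cauchy_iff by (meson zero_less_one)
  have "(\<lambda>e. (norm (blinfun_apply (hs_op (X N1)) e + - blinfun_apply (hs_op (X N1) - L) e))\<^sup>2) summable_on onb"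
    using diff[of N1 N1 1] N1 by (intro summable_on_add_sq hs_summable) auto
  then have "(\<lambda>e. (norm (blinfun_apply L e))\<^sup>2) summable_on onb"
    by (simp add: blinfun.diff_left)
  then have L': "hs_op (Abs_hs L) = L" by (simp add: Abs_hs_inverse)
  have "X \<longlonglongrightarrow> Abs_hs L"
    unfolding LIMSEQ_iff
  proof (intro allI impI)
    fix r :: real assume r: "0 < r"
    then obtain N where N: "\<forall>m\<ge>N. \<forall>n\<ge>N. norm (X m - X n) < r / 2"
      using X unfolding Cauchy_iff by (meson half_gt_zero)
    have "norm (X m - Abs_hs L) < r" if "m \<ge> N" for m
    proof -
      have Nm: "\<forall>n\<ge>N. norm (X m - X n) < r / 2" using N that by blast
      have "(norm (X m - Abs_hs L))\<^sup>2 \<le> (r / 2)\<^sup>2"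
        unfolding power2_norm_hs hs_op_minus L'
        using diff[OF Nm] bound[OF _ _ Nm] by (intro infsum_le_finite_sums) auto
      then have "norm (X m - Abs_hs L) \<le> r / 2"
        by (rule power2_le_imp_le) (use r in simp)
      then show ?thesis using r by simp
    qed
    then show "\<exists>N. \<forall>n\<ge>N. norm (X n - Abs_hs L) < r" by blast
  qed
  then show "convergent X" unfolding convergent_def by blast
qed

lemma blinfun_apply_tens:
  "blinfun_apply (Blinfun (\<lambda>t. (y \<bullet> t) *\<^sub>R f)) t = (y \<bullet> t) *\<^sub>R f"
  by (rule bounded_linear_Blinfun_apply[THEN fun_cong])
     (rule bounded_linear_compose[OF bounded_linear_scaleR_left bounded_linear_inner_right])

lift_definition tens :: "'a::{real_inner,second_countable_topology} \<Rightarrow> 'b::real_inner \<Rightarrow> ('a, 'b) hs"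
    (infixr \<open>\<otimes>\<^sub>H\<^sub>S\<close> 75)
  is "\<lambda>y f. Blinfun (\<lambda>t. (y \<bullet> t) *\<^sub>R f)"
proof -
  fix y :: 'a and f :: 'b
  have "(\<lambda>e. (y \<bullet> e)\<^sup>2) summable_on onb"
  proof (rule nonneg_bdd_above_summable_on)
    show "bdd_above (sum (\<lambda>e. (y \<bullet> e)\<^sup>2) ` {F. F \<subseteq> onb \<and> finite F})"
      by (rule bdd_aboveI[of _ "(norm y)\<^sup>2"]) (use onb_bessel in blast)
  qed simp
  then have "(\<lambda>e. (y \<bullet> e)\<^sup>2 * (norm f)\<^sup>2) summable_on onb"
    by (rule summable_on_cmult_left)
  then show "(\<lambda>e. (norm (blinfun_apply (Blinfun (\<lambda>t. (y \<bullet> t) *\<^sub>R f)) e))\<^sup>2) summable_on onb"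
    unfolding blinfun_apply_tens by (simp add: power_mult_distrib)
qed

lemma hs_op_tens [simp]: "blinfun_apply (hs_op (y \<otimes>\<^sub>H\<^sub>S f)) t = (y \<bullet> t) *\<^sub>R f"
  unfolding tens.rep_eq by (rule blinfun_apply_tens)


section \<open>Expectation in a Hilbert space that need not be separable\<close>

text \<open>
  The library's Bochner integral is restricted to second countable spaces, whereas a reproducing
  kernel Hilbert space need not be separable. The expectation of a random element \<open>Z\<close> of a Hilbert
  space is therefore the element \<open>m\<close> representing the functional \<open>h \<mapsto> E \<langle>Z, h\<rangle>\<close>. It is unique if it
  exists, and it is the Bochner integral whenever the latter is defined.
\<close>

definition has_hilbert_expectation :: "'a measure \<Rightarrow> ('a \<Rightarrow> 'h::real_inner) \<Rightarrow> 'h \<Rightarrow> bool" where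
  "has_hilbert_expectation M Z m \<longleftrightarrow>
     (\<forall>h. integrable M (\<lambda>\<omega>. Z \<omega> \<bullet> h) \<and> (\<integral>\<omega>. Z \<omega> \<bullet> h \<partial>M) = m \<bullet> h)"

definition hilbert_expectation :: "'a measure \<Rightarrow> ('a \<Rightarrow> 'h::real_inner) \<Rightarrow> 'h" where
  "hilbert_expectation M Z = (THE m. has_hilbert_expectation M Z m)"

lemma hilbert_expectation_eqI:
  assumes "has_hilbert_expectation M Z m"
  shows "hilbert_expectation M Z = m"
  unfolding hilbert_expectation_def
proof (rule the_equality)
  fix m' assume "has_hilbert_expectation M Z m'"
  then have "m' \<bullet> h = m \<bullet> h" for h
    using assms unfolding has_hilbert_expectation_def by metis
  then show "m' = m" by (metis vector_eq_rdot)
qed fact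

lemma hilbert_expectation_eq_integral:
  fixes Z :: "'a \<Rightarrow> 'h::{real_inner,banach,second_countable_topology}"
  assumes "integrable M Z"
  shows "hilbert_expectation M Z = integral\<^sup>L M Z"
  using assms
  by (intro hilbert_expectation_eqI) (auto simp: has_hilbert_expectation_def)

section \<open>Reproducing kernel Hilbert spaces\<close>

text \<open>
  A Hilbert space of functions on \<open>'x\<close> is a Hilbert space \<open>'h\<close> with an injective linear map \<open>evl\<close>
  assigning to each element the function it is; \<open>evl f x\<close> is the value of \<open>f\<close> at \<open>x\<close>.
\<close>

definition is_rkhs :: "('h::real_inner \<Rightarrow> 'x \<Rightarrow> real) \<Rightarrow> ('x \<Rightarrow> 'x \<Rightarrow> real) \<Rightarrow> bool" where
  "is_rkhs evl K \<longleftrightarrow>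
     inj evl \<and>
     (\<forall>f g x. evl (f + g) x = evl f x + evl g x) \<and>
     (\<forall>c f x. evl (c *\<^sub>R f) x = c * evl f x) \<and>
     (\<forall>x. \<exists>k. evl k = K x \<and> (\<forall>f. evl f x = k \<bullet> f))"

definition kernel_section :: "('h::real_inner \<Rightarrow> 'x \<Rightarrow> real) \<Rightarrow> ('x \<Rightarrow> 'x \<Rightarrow> real) \<Rightarrow> 'x \<Rightarrow> 'h" where
  "kernel_section evl K x = (THE k. evl k = K x)"

lemma
  assumes "is_rkhs evl K"
  shows evl_kernel_section: "evl (kernel_section evl K x) = K x"
    and kernel_section_reproducing: "evl f x = kernel_section evl K x \<bullet> f"
    and kernel_section_inner: "K x y = kernel_section evl K x \<bullet> kernel_section evl K y"
    and kernel_symmetric: "K x y = K y x"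
proof -
  have sec: "evl (kernel_section evl K x) = K x \<and> (\<forall>f. evl f x = kernel_section evl K x \<bullet> f)" for x
  proof -
    obtain k where k: "evl k = K x" "\<forall>f. evl f x = k \<bullet> f"
      using assms unfolding is_rkhs_def by blast
    have "kernel_section evl K x = k"
      unfolding kernel_section_def using k(1) assms
      by (intro the_equality) (auto simp: is_rkhs_def intro: injD[of evl])
    with k show ?thesis by simp
  qed
  show "evl (kernel_section evl K x) = K x" "evl f x = kernel_section evl K x \<bullet> f"
    using sec by auto
  show "K x y = kernel_section evl K x \<bullet> kernel_section evl K y"
    using sec by (metis inner_commute)
  then show "K x y = K y x" using sec by (metis inner_commute)
qed

section \<open>Kernel-based conditional mean dependence\<close>

text \<open>In this section \<open>k x\<close> stands for \<open>K(x, \<cdot>)\<close> as an element of the reproducing kernel Hilbert space.\<close>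

definition kernel_mean :: "'a measure \<Rightarrow> ('x \<Rightarrow> 'h::real_inner) \<Rightarrow> ('a \<Rightarrow> 'x) \<Rightarrow> 'h" where
  "kernel_mean M k X = hilbert_expectation M (\<lambda>\<omega>. k (X \<omega>))"

definition kcmd_\<eta> :: "'a measure \<Rightarrow> ('x \<Rightarrow> 'h::real_inner) \<Rightarrow> ('a \<Rightarrow> 'x) \<Rightarrow>
    ('a \<Rightarrow> 'y::{real_inner,banach,second_countable_topology}) \<Rightarrow> ('y, 'h) hs" where
  "kcmd_\<eta> M k X Y = hilbert_expectation M (\<lambda>\<omega>. Y \<omega> \<otimes>\<^sub>H\<^sub>S k (X \<omega>))"

definition kcmd_\<nu> :: "'a measure \<Rightarrow> ('x \<Rightarrow> 'h::real_inner) \<Rightarrow> ('a \<Rightarrow> 'x) \<Rightarrow>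
    ('a \<Rightarrow> 'y::{real_inner,banach,second_countable_topology}) \<Rightarrow> ('y, 'h) hs" where
  "kcmd_\<nu> M k X Y = (\<integral>\<omega>. Y \<omega> \<partial>M) \<otimes>\<^sub>H\<^sub>S kernel_mean M k X"

definition KCMD :: "'a measure \<Rightarrow> ('x \<Rightarrow> 'h::real_inner) \<Rightarrow> ('a \<Rightarrow> 'x) \<Rightarrow>
    ('a \<Rightarrow> 'y::{real_inner,banach,second_countable_topology}) \<Rightarrow> real" where
  "KCMD M k X Y = (norm (kcmd_\<eta> M k X Y - kcmd_\<nu> M k X Y))\<^sup>2"

definition kcmd_U :: "'a measure \<Rightarrow> ('x \<Rightarrow> 'h::real_inner) \<Rightarrow> ('a \<Rightarrow> 'x) \<Rightarrow>
    ('a \<Rightarrow> 'y::{real_inner,banach,second_countable_topology}) \<Rightarrow> 'x \<Rightarrow> 'y \<Rightarrow> real" where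
  "kcmd_U M k X Y x y =
     (let \<mu> = (\<integral>\<omega>. Y \<omega> \<partial>M); m = kernel_mean M k X; \<eta> = kcmd_\<eta> M k X Y; \<nu> = kcmd_\<nu> M k X Y
      in (y \<otimes>\<^sub>H\<^sub>S k x - \<eta>) \<bullet> \<eta> + (y \<otimes>\<^sub>H\<^sub>S m + \<mu> \<otimes>\<^sub>H\<^sub>S k x - 2 *\<^sub>R \<nu>) \<bullet> (\<nu> - \<eta>))"

definition kcmd_V :: "'a measure \<Rightarrow> ('x \<Rightarrow> 'h::real_inner) \<Rightarrow> ('a \<Rightarrow> 'x) \<Rightarrow>
    ('a \<Rightarrow> 'y::{real_inner,banach,second_countable_topology}) \<Rightarrow> 'x \<Rightarrow> 'y \<Rightarrow> real" where
  "kcmd_V M k X Y x y = (y \<otimes>\<^sub>H\<^sub>S k x - kcmd_\<eta> M k X Y) \<bullet> kcmd_\<nu> M k X Y"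

definition kcmd_estimator ::
    "('x \<Rightarrow> 'x \<Rightarrow> real) \<Rightarrow> (nat \<Rightarrow> real) \<Rightarrow> nat \<Rightarrow> (nat \<Rightarrow> 'x) \<Rightarrow> (nat \<Rightarrow> 'y::real_inner) \<Rightarrow> real" where
  "kcmd_estimator K w n x y =
     1 / real n ^ 2 * (\<Sum>i=1..n. \<Sum>j=1..n. (y i \<bullet> y j) * K (x i) (x j))
   + 1 / real n ^ 4 * (\<Sum>i=1..n. \<Sum>j=1..n. \<Sum>q=1..n. \<Sum>r=1..n. (y q \<bullet> y r) * K (x i) (x j))
   - 2 / real n ^ 3 * (\<Sum>i=1..n. \<Sum>j=1..n. \<Sum>q=1..n. w i * (y i \<bullet> y q) * K (x i) (x j))"

section \<open>Covariance and normal laws\<close>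

definition covariance :: "'a measure \<Rightarrow> ('a \<Rightarrow> real) \<Rightarrow> ('a \<Rightarrow> real) \<Rightarrow> real" where
  "covariance M f g = (\<integral>\<omega>. (f \<omega> - (\<integral>\<omega>'. f \<omega>' \<partial>M)) * (g \<omega> - (\<integral>\<omega>'. g \<omega>' \<partial>M)) \<partial>M)"

text \<open>\<^const>\<open>normal_density\<close> with standard deviation \<open>0\<close> is the zero function, so the degenerate law is
  treated separately.\<close>

definition normal_law :: "real \<Rightarrow> real \<Rightarrow> real measure" where
  "normal_law m v =
     (if v = 0 then return borel m else density lborel (\<lambda>x. ennreal (normal_density m (sqrt v) x)))"

end

theory Submission
  imports Defs "HOL-Real_Asymp.Real_Asymp"
begin

text \<open>
  The three sums in the estimator are squared norms and inner products of empirical means in the space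
  of Hilbert-Schmidt operators (\<open>kcmd_estimator_eq_norms\<close>). With \<open>\<eta>\<^sub>n\<close> and \<open>\<eta>\<^sub>n\<^sup>w\<close> the plain and the weighted
  average of \<open>Y\<^sub>i \<otimes> K(X\<^sub>i, \<cdot>)\<close>, and \<open>\<nu>\<^sub>n\<close> the tensor product of the averages of \<open>Y\<^sub>i\<close> and of \<open>K(X\<^sub>i, \<cdot>)\<close>, it
  equals
  \<open>\<parallel>\<eta>\<^sub>n\<parallel>\<^sup>2 + \<parallel>\<nu>\<^sub>n\<parallel>\<^sup>2 - 2 \<langle>\<eta>\<^sub>n\<^sup>w, \<nu>\<^sub>n\<rangle>\<close>,
  whereas the target is \<open>\<parallel>\<eta>\<parallel>\<^sup>2 + \<parallel>\<nu>\<parallel>\<^sup>2 - 2 \<langle>\<eta>, \<nu>\<rangle>\<close>. Expanding around the true means, the first-order part of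
  the difference is \<open>1/n\<close> times the sum of \<open>2 U(X\<^sub>i, Y\<^sub>i) - 2 w\<^sub>i V(X\<^sub>i, Y\<^sub>i)\<close>. The weights are attached to
  \<open>V\<close> alone, which is why the limiting variance involves \<open>w\<^sup>2\<close> only through the variance of \<open>V\<close>: in the
  mixed term the weights are averaged once, and their mean tends to \<open>1\<close>.

  Everything else is bounded by squares of deviations of the empirical means (\<open>linearisation_error\<close>), or
  comes from the deviation of the mean weight from \<open>1\<close>, which is of order \<open>1/n\<close>. Deviations of empirical
  means have second moments of order \<open>1/n\<close> (\<open>weighted_sum_second_moment\<close>), so after multiplication by
  \<open>sqrt n\<close> the remainder has mean of order \<open>1 / sqrt n\<close>. The linear part is a normalised sum of
  independent centred variables dominated by \<open>2 \<bar>U\<bar> + 2 C \<bar>V\<bar>\<close>, where \<open>C\<close> bounds the weights. Such sums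
  satisfy a central limit theorem even with a vanishing remainder added (\<open>dominated_array_clt\<close>).

  The reproducing kernel Hilbert space may be non-separable, so the random elements \<open>K(X, \<cdot>)\<close> and
  \<open>Y \<otimes> K(X, \<cdot>)\<close> are handled through their inner products only. Measurability of these
  (\<open>measurable_feature_inner\<close>) and existence of the means (\<open>has_hilbert_expectation_hilbert_expectation\<close>)
  both rest on Riesz representation in an arbitrary Hilbert space.
\<close>

section \<open>Riesz representation and orthogonal projection\<close>

text \<open>
  The representing vector minimises \<open>\<parallel>h\<parallel>\<^sup>2 - 2 F h\<close> over the subspace. A minimising sequence is Cauchy
  by the parallelogram identity, and completeness and closedness provide its limit in the subspace. For
  \<open>F h = \<langle>x, h\<rangle>\<close> the representing vector is the orthogonal projection of \<open>x\<close>.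
\<close>
lemma riesz_on_closed_subspace:
  fixes S :: "'h::{real_inner,banach} set" and F :: "'h \<Rightarrow> real"
  assumes sub: "subspace S" and cl: "closed S" and F: "bounded_linear F"
  shows "\<exists>m\<in>S. \<forall>h\<in>S. F h = m \<bullet> h"
proof -
  interpret F: bounded_linear F by fact
  define Q where "Q = (\<lambda>h. h \<bullet> h - 2 * F h)"
  have bdd: "bdd_below (Q ` S)"
  proof (rule bdd_belowI2)
    fix h
    have "\<bar>F h\<bar> \<le> onorm F * norm h"
      using onorm[OF F, of h] by simp
    moreover have "0 \<le> (norm h - onorm F)\<^sup>2" by simp
    ultimately show "- (onorm F)\<^sup>2 \<le> Q h"
      unfolding Q_def power2_norm_eq_inner[symmetric] power2_diff by (simp add: algebra_simps)
  qed
  have ne: "Q ` S \<noteq> {}" using subspace_0[OF sub] by blast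
  define d where "d = Inf (Q ` S)"
  have d_le: "d \<le> Q h" if "h \<in> S" for h
    unfolding d_def using bdd that by (intro cInf_lower) auto
  have "\<exists>h\<in>S. Q h < d + 1 / real (Suc n)" for n
    using cInf_lessD[OF ne, of "d + 1 / real (Suc n)"] by (auto simp: d_def)
  then obtain x where xS: "\<And>n. x n \<in> S" and xQ: "\<And>n. Q (x n) < d + 1 / real (Suc n)"
    by metis
  have near: "(norm (x i - x j))\<^sup>2 < 2 / real (Suc i) + 2 / real (Suc j)" for i j
  proof -
    have "(1/2) *\<^sub>R (x i + x j) \<in> S"
      by (intro subspace_scale[OF sub] subspace_add[OF sub] xS)
    \<comment> \<open>parallelogram identity, in which the linear part of \<open>Q\<close> cancels\<close>
    moreover have "(norm (x i - x j))\<^sup>2 = 2 * Q (x i) + 2 * Q (x j) - 4 * Q ((1/2) *\<^sub>R (x i + x j))"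
      unfolding Q_def power2_norm_eq_inner
      by (simp add: F.scaleR F.add inner_add_left inner_add_right inner_diff_left inner_diff_right
          inner_commute algebra_simps)
    ultimately show ?thesis
      using d_le[of "(1/2) *\<^sub>R (x i + x j)"] xQ[of i] xQ[of j] by linarith
  qed
  have "Cauchy x"
    unfolding Cauchy_iff
  proof (intro allI impI)
    fix e :: real assume e: "0 < e"
    then obtain N where N: "4 / e\<^sup>2 < real N" using reals_Archimedean2 by blast
    have "norm (x i - x j) < e" if ij: "N \<le> i" "N \<le> j" for i j
    proof -
      have N0: "0 < real N" using N e by (smt (verit) divide_pos_pos zero_less_power)
      have "2 / real (Suc i) \<le> 2 / real N" "2 / real (Suc j) \<le> 2 / real N"
        using ij N0 by (intro divide_left_mono; simp)+
      then have "(norm (x i - x j))\<^sup>2 < 4 / real N" using near[of i j] by simp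
      also have "\<dots> < e\<^sup>2" using N N0 e by (simp add: field_simps)
      finally show ?thesis using e by (simp add: power2_less_imp_less)
    qed
    then show "\<exists>N. \<forall>i\<ge>N. \<forall>j\<ge>N. norm (x i - x j) < e" by blast
  qed
  then obtain m where m: "x \<longlonglongrightarrow> m" using Cauchy_convergent convergent_def by blast
  have mS: "m \<in> S" using closed_sequentially[OF cl] xS m by blast
  have "Q m \<le> d"
  proof (rule LIMSEQ_le)
    show "(\<lambda>n. Q (x n)) \<longlonglongrightarrow> Q m"
      unfolding Q_def by (intro tendsto_intros m F.tendsto)
    show "(\<lambda>n. d + 1 / real (Suc n)) \<longlonglongrightarrow> d"
      using tendsto_add[OF tendsto_const LIMSEQ_inverse_real_of_nat, of d]
      by (simp add: inverse_eq_divide)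
    show "\<exists>N. \<forall>n\<ge>N. Q (x n) \<le> d + 1 / real (Suc n)"
      using xQ less_imp_le by blast
  qed
  then have min: "Q m \<le> Q h" if "h \<in> S" for h using d_le[OF that] by linarith
  show ?thesis
  proof (intro bexI[OF _ mS] ballI)
    fix h assume h: "h \<in> S"
    define c where "c = m \<bullet> h - F h"
    define a where "a = h \<bullet> h + 1"
    have a: "1 \<le> a" by (simp add: a_def)
    \<comment> \<open>first-order condition at the minimiser; the step would be optimal for \<open>a = h \<bullet> h\<close>, and the extra
      \<open>1\<close> in \<open>a\<close> covers \<open>h = 0\<close>\<close>
    have "m + (- c / a) *\<^sub>R h \<in> S"
      by (intro subspace_add[OF sub] subspace_scale[OF sub] mS h)
    from min[OF this] have "0 \<le> Q (m + (- c / a) *\<^sub>R h) - Q m" by simp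
    also have "Q (m + r *\<^sub>R h) - Q m = r\<^sup>2 * (h \<bullet> h) + 2 * r * c" for r
      unfolding Q_def c_def
      by (simp add: F.add F.scaleR inner_add_left inner_add_right inner_commute algebra_simps
          power2_eq_square)
    finally have "0 \<le> (c/a)\<^sup>2 * (h \<bullet> h) - 2 * (c / a) * c" by simp
    then have "0 \<le> ((c/a)\<^sup>2 * (h \<bullet> h) - 2 * (c / a) * c) * a\<^sup>2" by simp
    also have "\<dots> = (c / a * a)\<^sup>2 * (h \<bullet> h) - 2 * (c / a * a) * (a * c)"
      by (simp only: power2_eq_square algebra_simps)
    also have "c / a * a = c" using a by simp
    also have "c\<^sup>2 * (h \<bullet> h) - 2 * c * (a * c) = - c\<^sup>2 * (a + 1)"
      by (simp add: a_def power2_eq_square algebra_simps)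
    finally have "c\<^sup>2 * (a + 1) \<le> 0" by simp
    then have "c\<^sup>2 \<le> 0" using a by (simp add: mult_le_0_iff)
    then show "F h = m \<bullet> h" by (simp add: c_def)
  qed
qed

lemma riesz_representation:
  fixes F :: "'h::{real_inner,banach} \<Rightarrow> real"
  assumes "bounded_linear F"
  obtains m where "\<And>h. F h = m \<bullet> h"
  using riesz_on_closed_subspace[of UNIV F] assms by auto

lemma projection_on_closed_subspace:
  fixes S :: "'h::{real_inner,banach} set"
  assumes "subspace S" "closed S"
  obtains p where "p \<in> S" "\<And>g. g \<in> S \<Longrightarrow> (h - p) \<bullet> g = 0"
  using riesz_on_closed_subspace[OF assms bounded_linear_inner_right[of h]]
  by (auto simp: inner_diff_left)

section \<open>Random elements described by a measurable kernel\<close>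

text \<open>
  A random element \<open>\<Phi>(s)\<close> of a non-separable Hilbert space need not be Borel measurable. What a
  reproducing kernel provides is joint measurability of the inner products \<open>\<langle>\<Phi>(s), \<Phi>(t)\<rangle>\<close>, and this
  is enough for first and second moments.
\<close>
definition measurable_feature :: "'s measure \<Rightarrow> ('s \<Rightarrow> 'h::real_inner) \<Rightarrow> bool" where
  "measurable_feature N \<Phi> \<longleftrightarrow> (\<lambda>(s, t). \<Phi> s \<bullet> \<Phi> t) \<in> borel_measurable (N \<Otimes>\<^sub>M N)"

text \<open>
  The vectors \<open>h\<close> for which \<open>s \<mapsto> \<langle>\<Phi>(s), h\<rangle>\<close> is measurable form a closed subspace containing all
  \<open>\<Phi>(t)\<close>. The component of \<open>h\<close> orthogonal to it is therefore orthogonal to every \<open>\<Phi>(t)\<close> and does not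
  contribute to \<open>\<langle>\<Phi>(s), h\<rangle>\<close>.
\<close>
lemma measurable_feature_inner:
  fixes \<Phi> :: "'s \<Rightarrow> 'h::{real_inner,banach}"
  assumes "measurable_feature N \<Phi>"
  shows "(\<lambda>s. \<Phi> s \<bullet> h) \<in> borel_measurable N"
proof -
  define G where "G = {h. (\<lambda>s. \<Phi> s \<bullet> h) \<in> borel_measurable N}"
  have sub: "subspace G"
    unfolding G_def by (intro subspaceI) (auto simp: inner_add_right)
  have cl: "closed G"
    unfolding closed_sequential_limits
  proof (intro allI impI, elim conjE)
    fix g l assume g: "\<forall>n. g n \<in> G" "g \<longlonglongrightarrow> l"
    have "(\<lambda>s. \<Phi> s \<bullet> l) \<in> borel_measurable N"
    proof (rule borel_measurable_LIMSEQ_real)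
      show "(\<lambda>n. \<Phi> s \<bullet> g n) \<longlonglongrightarrow> \<Phi> s \<bullet> l" for s
        by (intro tendsto_intros g(2))
      show "(\<lambda>s. \<Phi> s \<bullet> g n) \<in> borel_measurable N" for n
        using g(1) by (simp add: G_def)
    qed
    then show "l \<in> G" by (simp add: G_def)
  qed
  obtain p where p: "p \<in> G" "\<And>g. g \<in> G \<Longrightarrow> (h - p) \<bullet> g = 0"
    using projection_on_closed_subspace[OF sub cl] by blast
  have "\<Phi> t \<in> G" if "t \<in> space N" for t
    unfolding G_def mem_Collect_eq
    using measurable_compose[OF measurable_Pair2'[OF that] assms[unfolded measurable_feature_def]]
    by simp
  then have "\<Phi> t \<bullet> (h - p) = 0" if "t \<in> space N" for t
    using p(2) that by (metis inner_commute)
  then have "(\<lambda>s. \<Phi> s \<bullet> h) \<in> borel_measurable N \<longleftrightarrow> (\<lambda>s. \<Phi> s \<bullet> p) \<in> borel_measurable N"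
    by (intro measurable_cong) (simp add: inner_diff_right)
  then show ?thesis using p(1) by (simp add: G_def)
qed

lemma measurable_feature_norm:
  assumes "measurable_feature N \<Phi>"
  shows "(\<lambda>s. norm (\<Phi> s)) \<in> borel_measurable N"
proof -
  have [measurable]: "(\<lambda>(s, t). \<Phi> s \<bullet> \<Phi> t) \<in> borel_measurable (N \<Otimes>\<^sub>M N)"
    using assms by (simp add: measurable_feature_def)
  have "(\<lambda>s. case (s, s) of (s, t) \<Rightarrow> \<Phi> s \<bullet> \<Phi> t) \<in> borel_measurable N"
    by measurable
  then show ?thesis unfolding norm_eq_sqrt_inner by simp
qed

lemma measurable_feature_diff_const:
  fixes \<Phi> :: "'s \<Rightarrow> 'h::{real_inner,banach}"
  assumes "measurable_feature N \<Phi>"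
  shows "measurable_feature N (\<lambda>s. \<Phi> s - \<theta>)"
proof -
  have [measurable]: "(\<lambda>z. \<Phi> (fst z) \<bullet> \<Phi> (snd z)) \<in> borel_measurable (N \<Otimes>\<^sub>M N)"
    using assms by (simp add: measurable_feature_def split_beta')
  have [measurable]: "(\<lambda>s. \<Phi> s \<bullet> \<theta>) \<in> borel_measurable N" "(\<lambda>s. \<theta> \<bullet> \<Phi> s) \<in> borel_measurable N"
    using measurable_feature_inner[OF assms, of \<theta>] by (simp_all add: inner_commute)
  show ?thesis
    unfolding measurable_feature_def split_beta' inner_diff_left inner_diff_right
    by measurable
qed

text \<open>
  The mean is the Riesz representative of the bounded functional \<open>h \<mapsto> E \<langle>\<Phi>, h\<rangle>\<close>.
\<close>
lemma has_hilbert_expectation_hilbert_expectation: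
  fixes \<Phi> :: "'s \<Rightarrow> 'h::{real_inner,banach}"
  assumes \<Phi>: "\<And>h. (\<lambda>s. \<Phi> s \<bullet> h) \<in> borel_measurable N" and int: "integrable N (\<lambda>s. norm (\<Phi> s))"
  shows "has_hilbert_expectation N \<Phi> (hilbert_expectation N \<Phi>)"
proof -
  have i: "integrable N (\<lambda>s. \<Phi> s \<bullet> h)" for h
  proof (rule Bochner_Integration.integrable_bound)
    show "integrable N (\<lambda>s. norm (\<Phi> s) * norm h)" using int by simp
  qed (use \<Phi> in \<open>auto simp: Cauchy_Schwarz_ineq2\<close>)
  have "bounded_linear (\<lambda>h. \<integral>s. \<Phi> s \<bullet> h \<partial>N)"
  proof (rule bounded_linear_intro)
    fix h
    have "norm (\<integral>s. \<Phi> s \<bullet> h \<partial>N) \<le> (\<integral>s. norm (\<Phi> s \<bullet> h) \<partial>N)"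
      by (rule integral_norm_bound)
    also have "\<dots> \<le> (\<integral>s. norm (\<Phi> s) * norm h \<partial>N)"
      by (rule integral_mono) (use i int in \<open>auto simp: Cauchy_Schwarz_ineq2\<close>)
    finally have "norm (\<integral>s. \<Phi> s \<bullet> h \<partial>N) \<le> (\<integral>s. norm (\<Phi> s) * norm h \<partial>N)" .
    then show "norm (\<integral>s. \<Phi> s \<bullet> h \<partial>N) \<le> norm h * (\<integral>s. norm (\<Phi> s) \<partial>N)"
      by (simp add: mult.commute)
  qed (simp_all add: inner_add_right i)
  then obtain m where "\<And>h. (\<integral>s. \<Phi> s \<bullet> h \<partial>N) = m \<bullet> h"
    using riesz_representation by blast
  then have "has_hilbert_expectation N \<Phi> m"
    using i by (simp add: has_hilbert_expectation_def)
  then show ?thesis using hilbert_expectation_eqI by metis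
qed

lemma has_hilbert_expectation_centred:
  assumes "prob_space N" "has_hilbert_expectation N \<Phi> \<theta>"
  shows "has_hilbert_expectation N (\<lambda>s. \<Phi> s - \<theta>) 0"
proof -
  interpret prob_space N by fact
  show ?thesis
    using assms(2) by (simp add: has_hilbert_expectation_def inner_diff_left prob_space)
qed

lemma measurable_feature_cong_sets:
  assumes "sets N = sets N'"
  shows "measurable_feature N \<Phi> \<longleftrightarrow> measurable_feature N' \<Phi>"
  unfolding measurable_feature_def measurable_cong_sets[OF sets_pair_measure_cong[OF assms assms] refl] ..

lemma has_hilbert_expectation_distr:
  assumes "S \<in> measurable M N" "\<And>h. (\<lambda>s. \<Phi> s \<bullet> h) \<in> borel_measurable N"
  shows "has_hilbert_expectation (distr M N S) \<Phi> \<theta> \<longleftrightarrow> has_hilbert_expectation M (\<lambda>\<omega>. \<Phi> (S \<omega>)) \<theta>"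
  unfolding has_hilbert_expectation_def
    integrable_distr_eq[OF assms] integral_distr[OF assms] ..

lemma square_integrable_add:
  fixes f g :: "'a \<Rightarrow> real"
  assumes f: "f \<in> borel_measurable M" "integrable M (\<lambda>x. (f x)\<^sup>2)"
    and g: "g \<in> borel_measurable M" "integrable M (\<lambda>x. (g x)\<^sup>2)"
  shows "integrable M (\<lambda>x. (f x + g x)\<^sup>2)"
proof (rule Bochner_Integration.integrable_bound)
  show "integrable M (\<lambda>x. 2 * (f x)\<^sup>2 + 2 * (g x)\<^sup>2)" using f g by simp
  have "(a + b)\<^sup>2 \<le> 2 * a\<^sup>2 + 2 * b\<^sup>2" for a b :: real
    using sum_squares_bound[of a b] by (simp add: power2_sum)
  then show "AE x in M. norm ((f x + g x)\<^sup>2) \<le> norm (2 * (f x)\<^sup>2 + 2 * (g x)\<^sup>2)" by simp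
qed (use f g in simp)

lemma square_integrable_mult:
  fixes f g :: "'a \<Rightarrow> real"
  assumes f: "f \<in> borel_measurable M" "integrable M (\<lambda>x. (f x)\<^sup>2)"
    and g: "g \<in> borel_measurable M" "integrable M (\<lambda>x. (g x)\<^sup>2)"
  shows "integrable M (\<lambda>x. f x * g x)"
proof -
  have "integrable M (\<lambda>x. ((f x + g x)\<^sup>2 - (f x)\<^sup>2 - (g x)\<^sup>2) / 2)"
    using square_integrable_add[OF f g] f(2) g(2) by simp
  then show ?thesis by (simp add: power2_sum)
qed

lemma square_integrable_feature_inner:
  fixes \<Psi> :: "'s \<Rightarrow> 'h::{real_inner,banach}"
  assumes "measurable_feature N \<Psi>" "integrable N (\<lambda>s. (norm (\<Psi> s))\<^sup>2)"
  shows "integrable N (\<lambda>s. (\<Psi> s \<bullet> h)\<^sup>2)"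
proof (rule Bochner_Integration.integrable_bound)
  show "integrable N (\<lambda>s. (norm (\<Psi> s))\<^sup>2 * (norm h)\<^sup>2)" using assms(2) by simp
  have "(\<Psi> s \<bullet> h)\<^sup>2 \<le> (norm (\<Psi> s))\<^sup>2 * (norm h)\<^sup>2" for s
    using power_mono[OF Cauchy_Schwarz_ineq2[of "\<Psi> s" h], of 2] by (simp add: power_mult_distrib)
  then show "AE s in N. norm ((\<Psi> s \<bullet> h)\<^sup>2) \<le> norm ((norm (\<Psi> s))\<^sup>2 * (norm h)\<^sup>2)" by simp
qed (use measurable_feature_inner[OF assms(1)] in simp)

lemma square_integrable_diff_const:
  fixes \<Phi> :: "'s \<Rightarrow> 'h::{real_inner,banach}"
  assumes N: "prob_space N" and feat: "measurable_feature N \<Phi>"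
    and sq: "integrable N (\<lambda>s. (norm (\<Phi> s))\<^sup>2)"
  shows "integrable N (\<lambda>s. (norm (\<Phi> s - \<theta>))\<^sup>2)"
proof -
  interpret prob_space N by fact
  have m: "(\<lambda>s. norm (\<Phi> s)) \<in> borel_measurable N" by (rule measurable_feature_norm[OF feat])
  show ?thesis
  proof (rule Bochner_Integration.integrable_bound)
    show "integrable N (\<lambda>s. (norm (\<Phi> s) + norm \<theta>)\<^sup>2)"
      by (rule square_integrable_add[OF m sq]) simp_all
    show "(\<lambda>s. (norm (\<Phi> s - \<theta>))\<^sup>2) \<in> borel_measurable N"
      using measurable_feature_norm[OF measurable_feature_diff_const[OF feat]] by simp
    show "AE s in N. norm ((norm (\<Phi> s - \<theta>))\<^sup>2) \<le> norm ((norm (\<Phi> s) + norm \<theta>)\<^sup>2)"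
      by (intro AE_I2) (simp add: power_mono norm_triangle_ineq4)
  qed
qed

section \<open>Independent identically distributed samples\<close>

text \<open>
  The sample starts at index \<open>1\<close>. The measure \<open>D\<close> serves both as the common law and as the measurable
  space in which the observations live.
\<close>
locale iid_sample = prob_space M for M :: "'a measure" +
  fixes D :: "'s measure" and S :: "nat \<Rightarrow> 'a \<Rightarrow> 's"
  assumes indep: "indep_vars (\<lambda>_. D) S {1..}"
    and law: "\<And>i. 1 \<le> i \<Longrightarrow> distr M D (S i) = D"
begin

lemma sample_measurable: "1 \<le> i \<Longrightarrow> S i \<in> measurable M D"
  using indep unfolding indep_vars_def by auto

lemma prob_space_law: "prob_space D"
  using prob_space_distr[OF sample_measurable[of 1]] law[of 1] by simp

lemma integral_sample:
  fixes f :: "'s \<Rightarrow> real"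
  assumes "1 \<le> i" "f \<in> borel_measurable D"
  shows "(\<integral>\<omega>. f (S i \<omega>) \<partial>M) = integral\<^sup>L D f"
  using integral_distr[OF sample_measurable[OF assms(1)] assms(2)] law[OF assms(1)] by simp

lemma integrable_sample:
  fixes f :: "'s \<Rightarrow> real"
  assumes "1 \<le> i" "integrable D f"
  shows "integrable M (\<lambda>\<omega>. f (S i \<omega>))"
  using integrable_distr_eq[OF sample_measurable[OF assms(1)], of f] law[OF assms(1)] assms(2) by simp

lemma pair_law:
  assumes ij: "1 \<le> i" "1 \<le> j" "i \<noteq> j"
  shows "distr M (D \<Otimes>\<^sub>M D) (\<lambda>\<omega>. (S i \<omega>, S j \<omega>)) = D \<Otimes>\<^sub>M D"
proof -
  have "indep_var D (S i) D (S j)"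
    using indep_var_compose[OF indep_var_restrict[OF indep, of "{i}" "{j}"]
        measurable_component_singleton[of i "{i}"] measurable_component_singleton[of j "{j}"]] ij
    by (simp add: comp_def)
  then show ?thesis
    unfolding indep_var_distribution_eq using law ij by simp
qed

text \<open>
  Centred features of distinct observations are orthogonal in mean: by Fubini the inner integral
  \<open>\<integral> \<langle>\<Psi>(s), \<Psi>(t)\<rangle> dD(t)\<close> vanishes for each \<open>s\<close>. Hence second moments of weighted sums add up. All
  integrands are values of the scalar kernel \<open>\<langle>\<Psi>(s), \<Psi>(t)\<rangle>\<close>, so the Hilbert space may be non-separable.
\<close>
lemma weighted_sum_second_moment:
  fixes \<Psi> :: "'s \<Rightarrow> 'h::{real_inner,banach}"
  assumes feat: "measurable_feature D \<Psi>"
    and sq: "integrable D (\<lambda>s. (norm (\<Psi> s))\<^sup>2)"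
    and centred: "has_hilbert_expectation D \<Psi> 0"
    and I: "finite I" "I \<subseteq> {1..}"
  shows "integrable M (\<lambda>\<omega>. (norm (\<Sum>i\<in>I. c i *\<^sub>R \<Psi> (S i \<omega>)))\<^sup>2)"
    and "(\<integral>\<omega>. (norm (\<Sum>i\<in>I. c i *\<^sub>R \<Psi> (S i \<omega>)))\<^sup>2 \<partial>M)
           = (\<Sum>i\<in>I. (c i)\<^sup>2) * (\<integral>s. (norm (\<Psi> s))\<^sup>2 \<partial>D)"
proof -
  interpret D: prob_space D by (rule prob_space_law)
  interpret DD: pair_prob_space D D ..
  have meas: "(\<lambda>z. \<Psi> (fst z) \<bullet> \<Psi> (snd z)) \<in> borel_measurable (D \<Otimes>\<^sub>M D)"
    using feat by (simp add: measurable_feature_def split_beta')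
  have rv: "(\<lambda>\<omega>. (S i \<omega>, S j \<omega>)) \<in> measurable M (D \<Otimes>\<^sub>M D)" if "1 \<le> i" "1 \<le> j" for i j
    using sample_measurable that by simp
  have int: "integrable M (\<lambda>\<omega>. \<Psi> (S i \<omega>) \<bullet> \<Psi> (S j \<omega>))" if ij: "1 \<le> i" "1 \<le> j" for i j
  proof (rule Bochner_Integration.integrable_bound)
    show "integrable M (\<lambda>\<omega>. (norm (\<Psi> (S i \<omega>)))\<^sup>2 + (norm (\<Psi> (S j \<omega>)))\<^sup>2)"
      using integrable_sample[OF _ sq] ij by simp
    show "(\<lambda>\<omega>. \<Psi> (S i \<omega>) \<bullet> \<Psi> (S j \<omega>)) \<in> borel_measurable M"
      using measurable_compose[OF rv[OF ij] meas] by simp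
    have "norm (x \<bullet> y) \<le> norm ((norm x)\<^sup>2 + (norm y)\<^sup>2)" for x y :: 'h
    proof -
      have "norm (x \<bullet> y) \<le> norm x * norm y" by (simp add: Cauchy_Schwarz_ineq2)
      also have "\<dots> \<le> 2 * (norm x * norm y)" by simp
      also have "\<dots> \<le> (norm x)\<^sup>2 + (norm y)\<^sup>2"
        using sum_squares_bound[of "norm x" "norm y"] by simp
      finally show ?thesis by simp
    qed
    then show "AE \<omega> in M. norm (\<Psi> (S i \<omega>) \<bullet> \<Psi> (S j \<omega>))
        \<le> norm ((norm (\<Psi> (S i \<omega>)))\<^sup>2 + (norm (\<Psi> (S j \<omega>)))\<^sup>2)" by simp
  qed
  have cross: "(\<integral>\<omega>. \<Psi> (S i \<omega>) \<bullet> \<Psi> (S j \<omega>) \<partial>M) = (if i = j then \<integral>s. (norm (\<Psi> s))\<^sup>2 \<partial>D else 0)"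
    if ij: "1 \<le> i" "1 \<le> j" for i j
  proof (cases "i = j")
    case True
    then show ?thesis
      using integral_sample[OF ij(1), of "\<lambda>s. (norm (\<Psi> s))\<^sup>2"] sq
      by (simp add: power2_norm_eq_inner)
  next
    case False
    have "integrable (D \<Otimes>\<^sub>M D) (\<lambda>z. \<Psi> (fst z) \<bullet> \<Psi> (snd z))"
      using int[OF ij] integrable_distr_eq[OF rv[OF ij] meas] pair_law[OF ij False] by simp
    from DD.integral_fst'[OF this]
    have "integral\<^sup>L (D \<Otimes>\<^sub>M D) (\<lambda>z. \<Psi> (fst z) \<bullet> \<Psi> (snd z)) = (\<integral>s. (\<integral>t. \<Psi> s \<bullet> \<Psi> t \<partial>D) \<partial>D)"
      by simp
    also have "\<dots> = 0"
      using centred by (simp add: has_hilbert_expectation_def inner_commute)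
    finally show ?thesis
      using integral_distr[OF rv[OF ij] meas] pair_law[OF ij False] False by simp
  qed
  have expand: "(norm (\<Sum>i\<in>I. c i *\<^sub>R \<Psi> (S i \<omega>)))\<^sup>2
      = (\<Sum>i\<in>I. \<Sum>j\<in>I. (c i * c j) * (\<Psi> (S i \<omega>) \<bullet> \<Psi> (S j \<omega>)))" for \<omega>
    unfolding power2_norm_eq_inner inner_sum_left inner_sum_right
    by (simp add: ac_simps inner_commute)
  have I1: "1 \<le> i" if "i \<in> I" for i using I that by auto
  have hbi: "has_bochner_integral M (\<lambda>\<omega>. (norm (\<Sum>i\<in>I. c i *\<^sub>R \<Psi> (S i \<omega>)))\<^sup>2)
      (\<Sum>i\<in>I. \<Sum>j\<in>I. (c i * c j) * (\<integral>\<omega>. \<Psi> (S i \<omega>) \<bullet> \<Psi> (S j \<omega>) \<partial>M))"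
    unfolding expand
    by (intro has_bochner_integral_sum has_bochner_integral_mult_right
        has_bochner_integral_integrable int I1)
  then show "integrable M (\<lambda>\<omega>. (norm (\<Sum>i\<in>I. c i *\<^sub>R \<Psi> (S i \<omega>)))\<^sup>2)"
    by (rule integrable.intros)
  have "(\<integral>\<omega>. (norm (\<Sum>i\<in>I. c i *\<^sub>R \<Psi> (S i \<omega>)))\<^sup>2 \<partial>M)
      = (\<Sum>i\<in>I. \<Sum>j\<in>I. (c i * c j) * (\<integral>\<omega>. \<Psi> (S i \<omega>) \<bullet> \<Psi> (S j \<omega>) \<partial>M))"
    using hbi by (rule has_bochner_integral_integral_eq)
  also have "\<dots> = (\<Sum>i\<in>I. \<Sum>j\<in>I. if i = j then (c i)\<^sup>2 * (\<integral>s. (norm (\<Psi> s))\<^sup>2 \<partial>D) else 0)"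
    by (intro sum.cong refl) (simp add: cross[OF I1 I1] power2_eq_square)
  finally show "(\<integral>\<omega>. (norm (\<Sum>i\<in>I. c i *\<^sub>R \<Psi> (S i \<omega>)))\<^sup>2 \<partial>M)
      = (\<Sum>i\<in>I. (c i)\<^sup>2) * (\<integral>s. (norm (\<Psi> s))\<^sup>2 \<partial>D)"
    using I(1) by (simp add: sum_distrib_right)
qed

end


section \<open>A central limit theorem for dominated triangular arrays\<close>
lemma exp_minus_first_order:
  fixes a :: real
  assumes "0 \<le> a"
  shows "\<bar>(1 - a) - exp (- a)\<bar> \<le> a\<^sup>2"
proof -
  have "1 \<le> (1 + a) * (1 - a + a\<^sup>2)"
    using assms by (simp add: algebra_simps power2_eq_square)
  also have "\<dots> \<le> exp a * (1 - a + a\<^sup>2)"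
  proof (rule mult_right_mono[OF exp_ge_add_one_self])
    have "0 \<le> (1 - a / 2)\<^sup>2 + 3/4 * a\<^sup>2" by simp
    then show "0 \<le> 1 - a + a\<^sup>2" by (simp add: power2_eq_square algebra_simps)
  qed
  finally have "exp (- a) \<le> 1 - a + a\<^sup>2"
    by (simp add: exp_minus field_simps)
  moreover have "1 - a \<le> exp (- a)" using exp_ge_add_one_self[of "- a"] by simp
  ultimately show ?thesis by simp
qed

lemma real_distribution_normal_law:
  assumes "0 \<le> v"
  shows "real_distribution (normal_law 0 v)"
proof (cases "v = 0")
  case True
  then show ?thesis
    by (auto simp: normal_law_def real_distribution_def real_distribution_axioms_def
        intro: prob_space_return)
next
  case False
  then show ?thesis
    using assms prob_space_normal_density[of "sqrt v" 0]
    by (auto simp: normal_law_def real_distribution_def real_distribution_axioms_def)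
qed

lemma char_normal_law:
  assumes "0 \<le> v"
  shows "char (normal_law 0 v) t = complex_of_real (exp (- (t\<^sup>2 * v / 2)))"
proof (cases "v = 0")
  case True
  then show ?thesis by (simp add: normal_law_def char_def integral_return)
next
  case False
  then have v: "0 < v" using assms by simp
  let ?N = "std_normal_distribution"
  interpret N: prob_space ?N
    using prob_space_normal_density[of 1 0] by simp
  have "distributed ?N lborel (\<lambda>x. x) (normal_density 0 1)"
    by (auto simp: distributed_def distr_id2 cong: distr_cong)
  then have "distributed ?N lborel (\<lambda>x. 0 + sqrt v * x)
      (normal_density (0 + sqrt v * 0) (\<bar>sqrt v\<bar> * 1))"
    using v by (intro N.normal_density_affine) auto
  then have "normal_law 0 v = distr ?N lborel (\<lambda>x. sqrt v * x)"
    using v by (simp add: normal_law_def distributed_def)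
  then have "char (normal_law 0 v) t = char ?N (t * sqrt v)"
    by (simp add: char_def integral_distr mult.assoc)
  also have "\<dots> = complex_of_real (exp (- (t\<^sup>2 * v / 2)))"
    using v by (simp add: char_std_normal_distribution power_mult_distrib)
  finally show ?thesis .
qed


lemma norm_iexp_diff_le: "norm (iexp x - iexp y) \<le> \<bar>x - y\<bar>"
proof -
  have "iexp x - iexp y = iexp y * (iexp (x - y) - 1)"
    by (simp add: right_diff_distrib exp_add[symmetric] of_real_diff)
  then have "norm (iexp x - iexp y) = norm (iexp (x - y) - 1)"
    by (simp add: norm_mult)
  also have "\<dots> \<le> \<bar>x - y\<bar>" using iexp_approx1[of "x - y" 0] by simp
  finally show ?thesis .
qed

text \<open>
  The summands \<open>f n i (S i)\<close> are not identically distributed, but they are dominated by one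
  square-integrable function of identically distributed observations. This uniform domination replaces
  Lindeberg's condition: the third-order error in the expansion of each characteristic function is at
  most \<open>t\<^sup>2 / 6 \<cdot> e n / n\<close>, with a common sequence \<open>e\<close> that tends to \<open>0\<close> by dominated convergence. Comparing the
  product of the characteristic functions factor by factor with the product of the Gaussian factors
  \<open>exp (- t\<^sup>2 \<sigma> n i / (2 n))\<close> gives the limit. A remainder bounded by \<open>r n\<close> with mean tending to \<open>0\<close> moves
  the characteristic function at \<open>t\<close> by at most \<open>\<bar>t\<bar> E (r n)\<close>.
\<close>
lemma (in iid_sample) dominated_array_clt:
  fixes f :: "nat \<Rightarrow> nat \<Rightarrow> 's \<Rightarrow> real" and T r :: "nat \<Rightarrow> 'a \<Rightarrow> real"
  assumes f: "\<And>n i. f n i \<in> borel_measurable D"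
    and G: "G \<in> borel_measurable D" "integrable D (\<lambda>s. (G s)\<^sup>2)"
    and dom: "\<And>n i s. 1 \<le> i \<Longrightarrow> i \<le> n \<Longrightarrow> \<bar>f n i s\<bar> \<le> G s"
    and mean: "\<And>n i. (\<integral>s. f n i s \<partial>D) = 0"
    and var: "(\<lambda>n. (\<Sum>i=1..n. \<integral>s. (f n i s)\<^sup>2 \<partial>D) / real n) \<longlonglongrightarrow> v"
    and T: "\<And>n. T n \<in> borel_measurable M"
    and r: "\<And>n. integrable M (r n)" "(\<lambda>n. \<integral>\<omega>. r n \<omega> \<partial>M) \<longlonglongrightarrow> 0"
    and T_approx: "\<And>n \<omega>. \<bar>T n \<omega> - (\<Sum>i=1..n. f n i (S i \<omega>)) / sqrt (real n)\<bar> \<le> r n \<omega>"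
  shows "weak_conv_m (\<lambda>n. distr M borel (T n)) (normal_law 0 v)"
proof (rule levy_continuity)
  interpret D: prob_space D by (rule prob_space_law)
  define \<sigma> where "\<sigma> n i = (\<integral>s. (f n i s)\<^sup>2 \<partial>D)" for n i
  define g where "g = (\<integral>s. (G s)\<^sup>2 \<partial>D)"
  have G0: "0 \<le> G s" for s using dom[of 1 1 s] by simp
  have \<sigma>0: "0 \<le> \<sigma> n i" for n i by (simp add: \<sigma>_def)
  have f2_le: "(f n i s)\<^sup>2 \<le> (G s)\<^sup>2" if "1 \<le> i" "i \<le> n" for n i s
    using power_mono[OF dom[OF that], of s 2] by simp
  have f2: "integrable D (\<lambda>s. (f n i s)\<^sup>2)" if "1 \<le> i" "i \<le> n" for n i
    by (rule Bochner_Integration.integrable_bound[OF G(2)]) (use f f2_le[OF that] in auto)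
  have \<sigma>g: "\<sigma> n i \<le> g" if "1 \<le> i" "i \<le> n" for n i
    unfolding \<sigma>_def g_def by (intro integral_mono f2 G(2) f2_le that)
  have v0: "0 \<le> v"
    by (rule LIMSEQ_le_const[OF var]) (auto intro!: exI[of _ 0] divide_nonneg_nonneg sum_nonneg)
  show "real_distribution (distr M borel (T n))" for n
    using T by (rule real_distribution_distr)
  show "real_distribution (normal_law 0 v)"
    using v0 by (rule real_distribution_normal_law)
  fix t :: real
  define \<xi> where "\<xi> n i \<omega> = f n i (S i \<omega>) / sqrt (real n)" for n i \<omega>
  have f_rv: "(\<lambda>\<omega>. f n i (S i \<omega>)) \<in> borel_measurable M" if "1 \<le> i" for n i
    using measurable_compose[OF sample_measurable[OF that] f] .
  have \<xi>_rv: "\<xi> n i \<in> borel_measurable M" if "1 \<le> i" for n i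
    using f_rv[OF that, of n] by (simp add: \<xi>_def[abs_def])
  have L_rv: "(\<lambda>\<omega>. \<Sum>i=1..n. \<xi> n i \<omega>) \<in> borel_measurable M" for n
    by (intro borel_measurable_sum \<xi>_rv) auto
  define e where "e n = (\<integral>s. min (6 * (G s)\<^sup>2) (\<bar>t\<bar> / sqrt (real n) * G s ^ 3) \<partial>D)" for n :: nat
  have min_int: "integrable D (\<lambda>s. min (6 * (G s)\<^sup>2) (\<bar>t\<bar> / sqrt (real n) * G s ^ 3))" for n
    by (rule Bochner_Integration.integrable_bound[of D "\<lambda>s. 6 * (G s)\<^sup>2"])
       (use G G0 in \<open>auto simp: min_def\<close>)
  have e: "e \<longlonglongrightarrow> 0"
  proof -
    have "(\<lambda>n. \<integral>s. min (6 * (G s)\<^sup>2) (\<bar>t\<bar> / sqrt (real n) * G s ^ 3) \<partial>D) \<longlonglongrightarrow> (\<integral>s. 0 \<partial>D)"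
    proof (rule integral_dominated_convergence[where w="\<lambda>s. 6 * (G s)\<^sup>2"])
      show "AE s in D. (\<lambda>n. min (6 * (G s)\<^sup>2) (\<bar>t\<bar> / sqrt (real n) * G s ^ 3)) \<longlonglongrightarrow> 0"
      proof (rule AE_I2)
        fix s
        have "(\<lambda>n. \<bar>t\<bar> / sqrt (real n) * G s ^ 3) \<longlonglongrightarrow> 0" by real_asymp
        from tendsto_min[OF tendsto_const this, of "6 * (G s)\<^sup>2"]
        show "(\<lambda>n. min (6 * (G s)\<^sup>2) (\<bar>t\<bar> / sqrt (real n) * G s ^ 3)) \<longlonglongrightarrow> 0"
          by (simp add: min_absorb2)
      qed
    qed (use G G0 in \<open>auto simp: min_def\<close>)
    then show ?thesis by (simp add: e_def[abs_def])
  qed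
  have factor: "cmod (char (distr M borel (\<xi> n i)) t - complex_of_real (exp (- (t\<^sup>2 * \<sigma> n i / (2 * n)))))
      \<le> t\<^sup>2 / 6 * (e n / n) + (t\<^sup>2 * g / 2)\<^sup>2 / (real n)\<^sup>2"
    if i: "1 \<le> i" "i \<le> n" for n i
  proof -
    have n: "0 < real n" using i by simp
    have \<xi>2: "(\<xi> n i \<omega>)\<^sup>2 = (f n i (S i \<omega>))\<^sup>2 / n" for \<omega>
      using n by (simp add: \<xi>_def power_divide)
    have f2S: "integrable M (\<lambda>\<omega>. (f n i (S i \<omega>))\<^sup>2)"
      by (rule integrable_sample[OF i(1) f2[OF i]])
    have sq: "integrable M (\<lambda>\<omega>. (\<xi> n i \<omega>)\<^sup>2)" unfolding \<xi>2 using f2S by simp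
    have m: "expectation (\<xi> n i) = 0"
      using integral_sample[OF i(1) f, of n i] mean by (simp add: \<xi>_def[abs_def])
    have vr: "variance (\<xi> n i) = \<sigma> n i / n"
      unfolding m using integral_sample[OF i(1), of "\<lambda>s. (f n i s)\<^sup>2"] f
      by (simp add: \<xi>2 \<sigma>_def)
    have mom: "integrable M (\<xi> n i)"
      by (rule square_integrable_imp_integrable[OF \<xi>_rv[OF i(1)] sq])
    have "cmod (char (distr M borel (\<xi> n i)) t - (1 - t\<^sup>2 * (\<sigma> n i / n) / 2))
        \<le> t\<^sup>2 / 6 * expectation (\<lambda>\<omega>. min (6 * (\<xi> n i \<omega>)\<^sup>2) (\<bar>t\<bar> * \<bar>\<xi> n i \<omega>\<bar> ^ 3))"
      by (rule char_approx3'[OF \<xi>_rv[OF i(1)] mom sq m vr refl])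
    also have "expectation (\<lambda>\<omega>. min (6 * (\<xi> n i \<omega>)\<^sup>2) (\<bar>t\<bar> * \<bar>\<xi> n i \<omega>\<bar> ^ 3))
        \<le> expectation (\<lambda>\<omega>. min (6 * (G (S i \<omega>))\<^sup>2) (\<bar>t\<bar> / sqrt n * G (S i \<omega>) ^ 3) / n)"
    proof (rule integral_mono)
      show "integrable M (\<lambda>\<omega>. min (6 * (\<xi> n i \<omega>)\<^sup>2) (\<bar>t\<bar> * \<bar>\<xi> n i \<omega>\<bar> ^ 3))"
        by (rule Bochner_Integration.integrable_bound[of M "\<lambda>\<omega>. 6 * (\<xi> n i \<omega>)\<^sup>2"])
           (use sq \<xi>_rv[OF i(1), of n] in \<open>auto simp: min_def\<close>)
      show "integrable M (\<lambda>\<omega>. min (6 * (G (S i \<omega>))\<^sup>2) (\<bar>t\<bar> / sqrt n * G (S i \<omega>) ^ 3) / n)"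
        using integrable_sample[OF i(1) min_int[of n]] by simp
      fix \<omega>
      let ?x = "\<bar>f n i (S i \<omega>)\<bar>" and ?G = "G (S i \<omega>)"
      have le: "?x \<le> ?G" by (rule dom[OF i])
      have "6 * (\<xi> n i \<omega>)\<^sup>2 \<le> 6 * ?G\<^sup>2 / n"
        unfolding \<xi>2 using f2_le[OF i, of "S i \<omega>"] n by (simp add: divide_right_mono)
      moreover have "\<bar>t\<bar> * \<bar>\<xi> n i \<omega>\<bar> ^ 3 \<le> \<bar>t\<bar> / sqrt n * ?G ^ 3 / n"
      proof -
        have "sqrt n ^ 3 = sqrt n * n" by (simp add: power3_eq_cube)
        then have "\<bar>t\<bar> * \<bar>\<xi> n i \<omega>\<bar> ^ 3 = \<bar>t\<bar> / sqrt n * ?x ^ 3 / n"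
          by (simp add: \<xi>_def power_divide)
        also have "\<dots> \<le> \<bar>t\<bar> / sqrt n * ?G ^ 3 / n"
          by (intro divide_right_mono mult_left_mono power_mono le) auto
        finally show ?thesis .
      qed
      ultimately show "min (6 * (\<xi> n i \<omega>)\<^sup>2) (\<bar>t\<bar> * \<bar>\<xi> n i \<omega>\<bar> ^ 3)
          \<le> min (6 * ?G\<^sup>2) (\<bar>t\<bar> / sqrt n * ?G ^ 3) / n"
        unfolding min_divide_distrib_right using n by (simp add: min.coboundedI1 min.coboundedI2)
    qed
    also have "\<dots> = e n / n"
      using integral_sample[OF i(1), of "\<lambda>s. min (6 * (G s)\<^sup>2) (\<bar>t\<bar> / sqrt n * G s ^ 3)"] G(1)
      by (simp add: e_def)
    finally have 1: "cmod (char (distr M borel (\<xi> n i)) t - (1 - t\<^sup>2 * (\<sigma> n i / n) / 2))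
        \<le> t\<^sup>2 / 6 * (e n / n)" by (simp add: mult_left_mono)
    define a where "a = t\<^sup>2 * \<sigma> n i / (2 * n)"
    have a0: "0 \<le> a" by (simp add: a_def \<sigma>0)
    have "a \<le> t\<^sup>2 * g / 2 / n"
      using \<sigma>g[OF i] n unfolding a_def by (simp add: field_simps mult_right_mono)
    then have "a\<^sup>2 \<le> (t\<^sup>2 * g / 2)\<^sup>2 / (real n)\<^sup>2"
      using power_mono[OF _ a0, of "t\<^sup>2 * g / 2 / n" 2] by (simp add: power_divide)
    moreover have "cmod (complex_of_real (1 - a) - complex_of_real (exp (- a))) \<le> a\<^sup>2"
      unfolding of_real_diff[symmetric] norm_of_real by (rule exp_minus_first_order[OF a0])
    ultimately have 2: "cmod (complex_of_real (1 - a) - complex_of_real (exp (- a)))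
        \<le> (t\<^sup>2 * g / 2)\<^sup>2 / (real n)\<^sup>2" by simp
    from 1 have "cmod (char (distr M borel (\<xi> n i)) t - complex_of_real (1 - a)) \<le> t\<^sup>2 / 6 * (e n / n)"
      by (simp add: a_def mult.commute)
    from norm_triangle_mono[OF this 2] show ?thesis by (simp add: a_def)
  qed
  have char_L: "(\<lambda>n. char (distr M borel (\<lambda>\<omega>. \<Sum>i=1..n. \<xi> n i \<omega>)) t) \<longlonglongrightarrow> char (normal_law 0 v) t"
  proof (rule Lim_transform)
    show "(\<lambda>n. complex_of_real (exp (- (t\<^sup>2 / 2 * ((\<Sum>i=1..n. \<sigma> n i) / n))))) \<longlonglongrightarrow> char (normal_law 0 v) t"
    proof -
      have "(\<lambda>n. complex_of_real (exp (- (t\<^sup>2 / 2 * ((\<Sum>i=1..n. \<sigma> n i) / n)))))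
          \<longlonglongrightarrow> complex_of_real (exp (- (t\<^sup>2 / 2 * v)))"
        unfolding \<sigma>_def
        by (intro tendsto_of_real tendsto_exp tendsto_minus tendsto_mult tendsto_const var)
      then show ?thesis by (simp add: char_normal_law[OF v0])
    qed
    have lim: "(\<lambda>n. t\<^sup>2 / 6 * e n + (t\<^sup>2 * g / 2)\<^sup>2 / real n) \<longlonglongrightarrow> 0"
      by (rule tendsto_eq_intros tendsto_mult_right_zero e lim_const_over_n | simp)+
    show "(\<lambda>n. char (distr M borel (\<lambda>\<omega>. \<Sum>i=1..n. \<xi> n i \<omega>)) t
        - complex_of_real (exp (- (t\<^sup>2 / 2 * ((\<Sum>i=1..n. \<sigma> n i) / n))))) \<longlonglongrightarrow> 0"
    proof (rule Lim_null_comparison[OF eventually_sequentiallyI[of 1] lim])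
      fix n :: nat assume n: "1 \<le> n"
      have "indep_vars (\<lambda>_. borel) (\<lambda>i. \<xi> n i) {1..n}"
        unfolding \<xi>_def[abs_def]
        by (rule indep_vars_compose2[OF indep_vars_subset[OF indep]]) (use f in auto)
      then have c1: "char (distr M borel (\<lambda>\<omega>. \<Sum>i=1..n. \<xi> n i \<omega>)) t = (\<Prod>i=1..n. char (distr M borel (\<xi> n i)) t)"
        by (rule char_distr_sum)
      have c2: "complex_of_real (exp (- (t\<^sup>2 / 2 * ((\<Sum>i=1..n. \<sigma> n i) / n))))
          = (\<Prod>i=1..n. complex_of_real (exp (- (t\<^sup>2 * \<sigma> n i / (2 * n)))))"
        by (simp add: of_real_prod[symmetric] exp_sum[symmetric] sum_negf sum_distrib_left sum_divide_distrib
            del: of_real_prod)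
      have "cmod ((\<Prod>i=1..n. char (distr M borel (\<xi> n i)) t)
            - (\<Prod>i=1..n. complex_of_real (exp (- (t\<^sup>2 * \<sigma> n i / (2 * n))))))
          \<le> (\<Sum>i=1..n. cmod (char (distr M borel (\<xi> n i)) t - complex_of_real (exp (- (t\<^sup>2 * \<sigma> n i / (2 * n))))))"
      proof (rule norm_prod_diff)
        fix i assume "i \<in> {1..n}"
        then have "real_distribution (distr M borel (\<xi> n i))"
          by (intro real_distribution_distr \<xi>_rv) auto
        then show "cmod (char (distr M borel (\<xi> n i)) t) \<le> 1"
          by (rule real_distribution.cmod_char_le_1)
        show "cmod (complex_of_real (exp (- (t\<^sup>2 * \<sigma> n i / (2 * n))))) \<le> 1"
          using \<sigma>0[of n i] by simp
      qed
      also have "\<dots> \<le> (\<Sum>i=1..n. t\<^sup>2 / 6 * (e n / n) + (t\<^sup>2 * g / 2)\<^sup>2 / (real n)\<^sup>2)"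
        by (intro sum_mono factor) auto
      also have "\<dots> = t\<^sup>2 / 6 * e n + (t\<^sup>2 * g / 2)\<^sup>2 / n"
        using n by (simp add: distrib_left power2_eq_square)
      finally show "cmod (char (distr M borel (\<lambda>\<omega>. \<Sum>i=1..n. \<xi> n i \<omega>)) t
          - complex_of_real (exp (- (t\<^sup>2 / 2 * ((\<Sum>i=1..n. \<sigma> n i) / n)))))
          \<le> t\<^sup>2 / 6 * e n + (t\<^sup>2 * g / 2)\<^sup>2 / n"
        unfolding c1 c2 .
    qed
  qed
  show "(\<lambda>n. char (distr M borel (T n)) t) \<longlonglongrightarrow> char (normal_law 0 v) t"
  proof (rule Lim_transform[OF char_L])
    have lim: "(\<lambda>n. \<bar>t\<bar> * (\<integral>\<omega>. r n \<omega> \<partial>M)) \<longlonglongrightarrow> 0"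
      by (rule tendsto_mult_right_zero[OF r(2)])
    show "(\<lambda>n. char (distr M borel (T n)) t - char (distr M borel (\<lambda>\<omega>. \<Sum>i=1..n. \<xi> n i \<omega>)) t) \<longlonglongrightarrow> 0"
    proof (rule Lim_null_comparison[OF always_eventually lim], rule allI)
      fix n
      let ?L = "\<lambda>\<omega>. \<Sum>i=1..n. \<xi> n i \<omega>"
      have L: "?L \<omega> = (\<Sum>i=1..n. f n i (S i \<omega>)) / sqrt n" for \<omega>
        by (simp add: \<xi>_def sum_divide_distrib)
      have iexp_int: "integrable M (\<lambda>\<omega>. iexp (t * Z \<omega>))" if "Z \<in> borel_measurable M" for Z
        using that by (intro integrable_iexp) auto
      have int: "integrable M (\<lambda>\<omega>. iexp (t * T n \<omega>))" "integrable M (\<lambda>\<omega>. iexp (t * ?L \<omega>))"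
        by (rule iexp_int[OF T], rule iexp_int[OF L_rv])
      have "char (distr M borel (T n)) t - char (distr M borel ?L) t
          = (CLINT \<omega>|M. iexp (t * T n \<omega>) - iexp (t * ?L \<omega>))"
        using T L_rv int by (simp add: char_def integral_distr)
      also have "cmod \<dots> \<le> (\<integral>\<omega>. cmod (iexp (t * T n \<omega>) - iexp (t * ?L \<omega>)) \<partial>M)"
        by (rule integral_norm_bound)
      also have "\<dots> \<le> (\<integral>\<omega>. \<bar>t\<bar> * r n \<omega> \<partial>M)"
      proof (rule integral_mono)
        fix \<omega>
        have "cmod (iexp (t * T n \<omega>) - iexp (t * ?L \<omega>)) \<le> \<bar>t * T n \<omega> - t * ?L \<omega>\<bar>"
          by (rule norm_iexp_diff_le)
        also have "\<dots> = \<bar>t\<bar> * \<bar>T n \<omega> - ?L \<omega>\<bar>"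
          by (simp add: right_diff_distrib[symmetric] abs_mult)
        also have "\<dots> \<le> \<bar>t\<bar> * r n \<omega>"
          unfolding L by (intro mult_left_mono T_approx) simp
        finally show "cmod (iexp (t * T n \<omega>) - iexp (t * ?L \<omega>)) \<le> \<bar>t\<bar> * r n \<omega>" .
      qed (use int r(1) in auto)
      finally show "cmod (char (distr M borel (T n)) t - char (distr M borel ?L) t)
          \<le> \<bar>t\<bar> * (\<integral>\<omega>. r n \<omega> \<partial>M)" by simp
    qed
  qed
qed

section \<open>Elementary tensors as Hilbert-Schmidt operators\<close>

lemma hs_eqI: "(\<And>t. blinfun_apply (hs_op A) t = blinfun_apply (hs_op B) t) \<Longrightarrow> A = B"
  unfolding hs_op_inject[symmetric] by (rule blinfun_eqI)

lemma norm_tens_le: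
  fixes y :: "'a::{real_inner,second_countable_topology}" and f :: "'b::real_inner"
  shows "norm (y \<otimes>\<^sub>H\<^sub>S f) \<le> norm y * norm f"
proof (rule power2_le_imp_le)
  have "(\<Sum>\<^sub>\<infinity>e\<in>onb. (norm (blinfun_apply (hs_op (y \<otimes>\<^sub>H\<^sub>S f)) e))\<^sup>2) \<le> (norm y * norm f)\<^sup>2"
  proof (rule infsum_le_finite_sums[OF hs_summable])
    fix F :: "'a set" assume F: "finite F" "F \<subseteq> onb"
    have "(\<Sum>e\<in>F. (norm (blinfun_apply (hs_op (y \<otimes>\<^sub>H\<^sub>S f)) e))\<^sup>2) = (\<Sum>e\<in>F. (y \<bullet> e)\<^sup>2) * (norm f)\<^sup>2"
      by (simp add: power_mult_distrib sum_distrib_right)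
    also have "\<dots> \<le> (norm y)\<^sup>2 * (norm f)\<^sup>2"
      by (intro mult_right_mono onb_bessel F) simp
    finally show "(\<Sum>e\<in>F. (norm (blinfun_apply (hs_op (y \<otimes>\<^sub>H\<^sub>S f)) e))\<^sup>2) \<le> (norm y * norm f)\<^sup>2"
      by (simp add: power_mult_distrib)
  qed
  then show "(norm (y \<otimes>\<^sub>H\<^sub>S f))\<^sup>2 \<le> (norm y * norm f)\<^sup>2" by (simp add: power2_norm_hs)
qed simp

interpretation tens: bounded_bilinear "tens :: 'a::{real_inner,second_countable_topology} \<Rightarrow> 'b::real_inner \<Rightarrow> _"
proof
  fix a a' :: 'a and b b' :: 'b and r :: real
  show "(a + a') \<otimes>\<^sub>H\<^sub>S b = a \<otimes>\<^sub>H\<^sub>S b + a' \<otimes>\<^sub>H\<^sub>S b"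
    by (rule hs_eqI) (simp add: plus_hs.rep_eq blinfun.add_left inner_add_left scaleR_add_left)
  show "a \<otimes>\<^sub>H\<^sub>S (b + b') = a \<otimes>\<^sub>H\<^sub>S b + a \<otimes>\<^sub>H\<^sub>S b'"
    by (rule hs_eqI) (simp add: plus_hs.rep_eq blinfun.add_left scaleR_add_right)
  show "(r *\<^sub>R a) \<otimes>\<^sub>H\<^sub>S b = r *\<^sub>R (a \<otimes>\<^sub>H\<^sub>S b)"
    by (rule hs_eqI) (simp add: scaleR_hs.rep_eq blinfun.scaleR_left)
  show "a \<otimes>\<^sub>H\<^sub>S (r *\<^sub>R b) = r *\<^sub>R (a \<otimes>\<^sub>H\<^sub>S b)"
    by (rule hs_eqI) (simp add: scaleR_hs.rep_eq blinfun.scaleR_left)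
  show "\<exists>K. \<forall>(a::'a) (b::'b). norm (a \<otimes>\<^sub>H\<^sub>S b) \<le> norm a * norm b * K"
    by (intro exI[of _ 1] allI) (simp add: norm_tens_le)
qed

text \<open>
  This contains Parseval's identity: both sides are bounded linear functionals of \<open>y\<close> that agree on the
  orthonormal basis, whose span is dense.
\<close>
lemma inner_tens_left: "(y \<otimes>\<^sub>H\<^sub>S f) \<bullet> A = f \<bullet> blinfun_apply (hs_op A) y"
proof -
  have lin: "bounded_linear (\<lambda>y. (y \<otimes>\<^sub>H\<^sub>S f) \<bullet> A - f \<bullet> blinfun_apply (hs_op A) y)"
    by (intro bounded_linear_sub bounded_linear_compose[OF bounded_linear_inner_left]
        bounded_linear_compose[OF bounded_linear_inner_right] tens.bounded_linear_left
        blinfun.bounded_linear_right)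
  interpret L: bounded_linear "\<lambda>y. (y \<otimes>\<^sub>H\<^sub>S f) \<bullet> A - f \<bullet> blinfun_apply (hs_op A) y" by (rule lin)
  have basis: "(e \<otimes>\<^sub>H\<^sub>S f) \<bullet> A - f \<bullet> blinfun_apply (hs_op A) e = 0" if e: "e \<in> onb" for e
  proof -
    have "(e \<otimes>\<^sub>H\<^sub>S f) \<bullet> A = (\<Sum>\<^sub>\<infinity>e'\<in>onb. (e \<bullet> e') * (f \<bullet> blinfun_apply (hs_op A) e'))"
      by (simp add: inner_hs_def)
    also have "\<dots> = (if e \<in> onb then (e \<bullet> e) * (f \<bullet> blinfun_apply (hs_op A) e) else 0)"
      using infsum_cong_neutral[of "{e}" onb "\<lambda>e'. (e \<bullet> e') * (f \<bullet> blinfun_apply (hs_op A) e')"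
          "\<lambda>e'. (e \<bullet> e') * (f \<bullet> blinfun_apply (hs_op A) e')"] onb_orthogonal[OF e] e
      by auto
    finally show ?thesis
      using e onb_norm[OF e] by (simp add: norm_eq_1)
  qed
  have "(y \<otimes>\<^sub>H\<^sub>S f) \<bullet> A - f \<bullet> blinfun_apply (hs_op A) y = 0"
  proof (rule continuous_constant_on_closure[where S = "span onb"
        and f = "\<lambda>y. (y \<otimes>\<^sub>H\<^sub>S f) \<bullet> A - f \<bullet> blinfun_apply (hs_op A) y"])
    show "continuous_on (closure (span onb)) (\<lambda>y. (y \<otimes>\<^sub>H\<^sub>S f) \<bullet> A - f \<bullet> blinfun_apply (hs_op A) y)"
      by (rule linear_continuous_on[OF lin])
    show "(z \<otimes>\<^sub>H\<^sub>S f) \<bullet> A - f \<bullet> blinfun_apply (hs_op A) z = 0" if "z \<in> span onb" for z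
      using linear_eq_0_on_span[OF L.linear basis that] .
    show "y \<in> closure (span onb)" by (simp add: closure_span_onb)
  qed
  then show ?thesis by simp
qed

lemma inner_tens_tens: "(y \<otimes>\<^sub>H\<^sub>S f) \<bullet> (z \<otimes>\<^sub>H\<^sub>S g) = (y \<bullet> z) * (f \<bullet> g)"
  by (simp add: inner_tens_left inner_commute)

lemma norm_tens: "norm (y \<otimes>\<^sub>H\<^sub>S f) = norm y * norm f"
  by (simp add: norm_eq_sqrt_inner inner_tens_tens real_sqrt_mult)


section \<open>The estimator and its linearisation\<close>

text \<open>
  The double, quadruple and triple sums of the estimator are the expansions of two squared norms and one
  inner product, formed from the empirical versions of \<open>\<eta>\<close>, \<open>\<nu>\<close> and the weighted empirical version of \<open>\<eta>\<close>.
\<close>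
lemma kcmd_estimator_eq_norms:
  fixes k :: "'x \<Rightarrow> 'h::real_inner" and y :: "nat \<Rightarrow> 'y::{real_inner,second_countable_topology}"
  assumes K: "\<And>s t. K s t = k s \<bullet> k t"
  shows "kcmd_estimator K w n x y =
      (norm (\<Sum>i=1..n. (1 / real n) *\<^sub>R (y i \<otimes>\<^sub>H\<^sub>S k (x i))))\<^sup>2
    + (norm ((\<Sum>i=1..n. (1 / real n) *\<^sub>R y i) \<otimes>\<^sub>H\<^sub>S (\<Sum>i=1..n. (1 / real n) *\<^sub>R k (x i))))\<^sup>2
    - 2 * ((\<Sum>i=1..n. (w i / real n) *\<^sub>R (y i \<otimes>\<^sub>H\<^sub>S k (x i)))
           \<bullet> ((\<Sum>i=1..n. (1 / real n) *\<^sub>R y i) \<otimes>\<^sub>H\<^sub>S (\<Sum>i=1..n. (1 / real n) *\<^sub>R k (x i))))"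
proof -
  let ?r = "1 / real n"
  have 1: "(norm (\<Sum>i=1..n. ?r *\<^sub>R (y i \<otimes>\<^sub>H\<^sub>S k (x i))))\<^sup>2
      = 1 / real n ^ 2 * (\<Sum>i=1..n. \<Sum>j=1..n. (y i \<bullet> y j) * K (x i) (x j))"
    unfolding power2_norm_eq_inner scaleR_sum_right[symmetric] inner_scaleR_left inner_scaleR_right
      inner_sum_left
    unfolding inner_sum_right inner_tens_tens K
    by (simp add: power2_eq_square)
  have 2: "(norm ((\<Sum>i=1..n. ?r *\<^sub>R y i) \<otimes>\<^sub>H\<^sub>S (\<Sum>i=1..n. ?r *\<^sub>R k (x i))))\<^sup>2
      = 1 / real n ^ 4 * (\<Sum>i=1..n. \<Sum>j=1..n. \<Sum>q=1..n. \<Sum>r=1..n. (y q \<bullet> y r) * K (x i) (x j))"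
  proof -
    have "(norm ((\<Sum>i=1..n. ?r *\<^sub>R y i) \<otimes>\<^sub>H\<^sub>S (\<Sum>i=1..n. ?r *\<^sub>R k (x i))))\<^sup>2
      = 1 / real n ^ 4 * ((\<Sum>q=1..n. \<Sum>r=1..n. y q \<bullet> y r) * (\<Sum>i=1..n. \<Sum>j=1..n. K (x i) (x j)))"
      unfolding norm_tens power_mult_distrib power2_norm_eq_inner scaleR_sum_right[symmetric]
        inner_scaleR_left inner_scaleR_right inner_sum_left
      unfolding inner_sum_right K
      by (simp add: power4_eq_xxxx)
    then show ?thesis by (simp only: sum_distrib_left sum_distrib_right)
  qed
  have 3: "(\<Sum>i=1..n. (w i / real n) *\<^sub>R (y i \<otimes>\<^sub>H\<^sub>S k (x i)))
           \<bullet> ((\<Sum>i=1..n. ?r *\<^sub>R y i) \<otimes>\<^sub>H\<^sub>S (\<Sum>i=1..n. ?r *\<^sub>R k (x i)))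
      = 1 / real n ^ 3 * (\<Sum>i=1..n. \<Sum>j=1..n. \<Sum>q=1..n. w i * (y i \<bullet> y q) * K (x i) (x j))"
  proof -
    have "(y i \<otimes>\<^sub>H\<^sub>S k (x i)) \<bullet> ((\<Sum>i=1..n. ?r *\<^sub>R y i) \<otimes>\<^sub>H\<^sub>S (\<Sum>i=1..n. ?r *\<^sub>R k (x i)))
        = 1 / real n ^ 2 * (\<Sum>j=1..n. \<Sum>q=1..n. (y i \<bullet> y q) * K (x i) (x j))" for i
      unfolding inner_tens_tens scaleR_sum_right[symmetric] inner_scaleR_right inner_sum_right K
      by (simp add: power2_eq_square sum_distrib_left sum_distrib_right sum_divide_distrib)
    then show ?thesis
      unfolding inner_sum_left inner_scaleR_left
      by (simp add: sum_distrib_left power3_eq_cube power2_eq_square ac_simps)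
  qed
  show ?thesis unfolding kcmd_estimator_def 1 2 3 by simp
qed

text \<open>
  Perturbing \<open>\<eta>\<close>, \<open>\<mu>\<close> and \<open>m\<close> in the estimator, as written by \<open>kcmd_estimator_eq_norms\<close>, around their true values: the terms
  of first order are kept, and what remains is of order at least two in the perturbations, apart from the
  error \<open>\<delta>\<close> of the mean weight. The a priori bound \<open>\<beta>\<close> on \<open>b\<close> (available because the kernel is bounded) turns
  the terms of degree three and four, which contain \<open>d \<otimes> b\<close>, into terms of degree two, so that second
  moments suffice to control everything.
\<close>
lemma linearisation_error:
  fixes \<eta> A A' :: "('y::{real_inner,second_countable_topology}, 'h::real_inner) hs"
    and \<mu> d :: 'y and m b :: 'h
  defines "\<nu> \<equiv> \<mu> \<otimes>\<^sub>H\<^sub>S m"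
  assumes b: "norm b \<le> \<beta>"
  shows "\<bar>((norm (\<eta> + A))\<^sup>2 + (norm ((\<mu> + d) \<otimes>\<^sub>H\<^sub>S (m + b)))\<^sup>2
           - 2 * (((1 + \<delta>) *\<^sub>R \<eta> + A') \<bullet> ((\<mu> + d) \<otimes>\<^sub>H\<^sub>S (m + b))) - (norm (\<eta> - \<nu>))\<^sup>2)
         - (2 * (A \<bullet> \<eta> + (d \<otimes>\<^sub>H\<^sub>S m + \<mu> \<otimes>\<^sub>H\<^sub>S b) \<bullet> (\<nu> - \<eta>)) - 2 * (A' \<bullet> \<nu>))\<bar>
      \<le> (1 + norm (\<nu> - \<eta>) + 6 * (norm m + \<beta>)\<^sup>2 + 6 * (norm \<mu>)\<^sup>2)
          * ((norm A)\<^sup>2 + (norm A')\<^sup>2 + (norm b)\<^sup>2 + (norm d)\<^sup>2)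
        + \<delta>\<^sup>2 * (norm \<eta>)\<^sup>2 + 2 * \<bar>\<delta>\<bar> * \<bar>\<eta> \<bullet> \<nu>\<bar>"
    (is "\<bar>?total - ?linear\<bar> \<le> (1 + ?\<kappa> + 6 * ?p\<^sup>2 + 6 * ?q\<^sup>2) * (?A + ?A' + ?b + ?d) + _ + _")
proof -
  define N where "N = d \<otimes>\<^sub>H\<^sub>S m + \<mu> \<otimes>\<^sub>H\<^sub>S b + d \<otimes>\<^sub>H\<^sub>S b"
  have \<nu>N: "(\<mu> + d) \<otimes>\<^sub>H\<^sub>S (m + b) = \<nu> + N"
    by (simp add: \<nu>_def N_def tens.add_left tens.add_right)
  have lin: "(d \<otimes>\<^sub>H\<^sub>S m + \<mu> \<otimes>\<^sub>H\<^sub>S b) = N - d \<otimes>\<^sub>H\<^sub>S b" by (simp add: N_def)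
  have eq: "?total - ?linear = (norm A)\<^sup>2 + (norm N)\<^sup>2 - 2 * (A' \<bullet> N)
      + 2 * ((d \<otimes>\<^sub>H\<^sub>S b) \<bullet> (\<nu> - \<eta>)) - 2 * (\<delta> * (\<eta> \<bullet> N)) - 2 * (\<delta> * (\<eta> \<bullet> \<nu>))"
    unfolding \<nu>N lin power2_norm_eq_inner
    by (simp add: inner_add_left inner_add_right inner_diff_left inner_diff_right algebra_simps
        inner_commute)
  have amgm: "2 * (s * t) \<le> s\<^sup>2 + t\<^sup>2" for s t :: real
    using sum_squares_bound[of s t] by simp
  have cs: "2 * \<bar>P \<bullet> Q\<bar> \<le> (norm P)\<^sup>2 + (norm Q)\<^sup>2" for P Q :: "('y, 'h) hs"
    using Cauchy_Schwarz_ineq2[of P Q] amgm[of "norm P" "norm Q"] by linarith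
  have "norm N \<le> norm d * norm m + norm \<mu> * norm b + norm d * norm b"
    unfolding N_def by (intro norm_triangle_le add_mono) (simp_all add: norm_tens)
  \<comment> \<open>the bound \<open>\<beta>\<close> is spent here, absorbing \<open>d \<otimes> b\<close> into a multiple of \<open>norm d\<close>\<close>
  also have "\<dots> \<le> norm d * ?p + ?q * norm b"
    using mult_left_mono[OF b norm_ge_zero[of d]] by (simp add: algebra_simps)
  finally have "(norm N)\<^sup>2 \<le> (norm d * ?p + ?q * norm b)\<^sup>2"
    by (intro power_mono) auto
  also have "\<dots> \<le> 2 * (norm d * ?p)\<^sup>2 + 2 * (?q * norm b)\<^sup>2"
    using amgm[of "norm d * ?p" "?q * norm b"] by (simp add: power2_sum)
  also have "\<dots> = 2 * ?p\<^sup>2 * ?d + 2 * ?q\<^sup>2 * ?b" by (simp only: power_mult_distrib mult_ac)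
  finally have N: "(norm N)\<^sup>2 \<le> 2 * ?p\<^sup>2 * ?d + 2 * ?q\<^sup>2 * ?b" .
  have cross: "2 * \<bar>(d \<otimes>\<^sub>H\<^sub>S b) \<bullet> (\<nu> - \<eta>)\<bar> \<le> ?\<kappa> * (?b + ?d)"
  proof -
    have "2 * \<bar>(d \<otimes>\<^sub>H\<^sub>S b) \<bullet> (\<nu> - \<eta>)\<bar> \<le> (2 * (norm d * norm b)) * ?\<kappa>"
      using Cauchy_Schwarz_ineq2[of "d \<otimes>\<^sub>H\<^sub>S b" "\<nu> - \<eta>"] by (simp add: norm_tens)
    also have "\<dots> \<le> (?d + ?b) * ?\<kappa>" by (intro mult_right_mono amgm) simp
    finally show ?thesis by (simp add: algebra_simps)
  qed
  have \<delta>N: "2 * \<bar>\<delta> * (\<eta> \<bullet> N)\<bar> \<le> \<delta>\<^sup>2 * (norm \<eta>)\<^sup>2 + (norm N)\<^sup>2"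
    using cs[of "\<delta> *\<^sub>R \<eta>" N] by (simp add: power_mult_distrib)
  have "\<bar>?total - ?linear\<bar> \<le> ?A + (norm N)\<^sup>2 + 2 * \<bar>A' \<bullet> N\<bar> + 2 * \<bar>(d \<otimes>\<^sub>H\<^sub>S b) \<bullet> (\<nu> - \<eta>)\<bar>
      + 2 * \<bar>\<delta> * (\<eta> \<bullet> N)\<bar> + 2 * \<bar>\<delta> * (\<eta> \<bullet> \<nu>)\<bar>"
  proof -
    have "\<bar>a + c - 2 * x + 2 * y - 2 * z - 2 * u\<bar> \<le> a + c + 2 * \<bar>x\<bar> + 2 * \<bar>y\<bar> + 2 * \<bar>z\<bar> + 2 * \<bar>u\<bar>"
      if "0 \<le> a" "0 \<le> c" for a c x y z u :: real
      using that by linarith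
    then show ?thesis unfolding eq by simp
  qed
  also have "\<dots> \<le> ?A + ?A' + 3 * (2 * ?p\<^sup>2 * ?d + 2 * ?q\<^sup>2 * ?b) + ?\<kappa> * (?b + ?d)
      + \<delta>\<^sup>2 * (norm \<eta>)\<^sup>2 + 2 * \<bar>\<delta>\<bar> * \<bar>\<eta> \<bullet> \<nu>\<bar>"
    using cs[of A' N] N cross \<delta>N by (simp add: abs_mult)
  also have "\<dots> \<le> (1 + ?\<kappa> + 6 * ?p\<^sup>2 + 6 * ?q\<^sup>2) * (?A + ?A' + ?b + ?d)
      + \<delta>\<^sup>2 * (norm \<eta>)\<^sup>2 + 2 * \<bar>\<delta>\<bar> * \<bar>\<eta> \<bullet> \<nu>\<bar>"
  proof -
    have "0 \<le> ?b + ?d + ?\<kappa> * (?A + ?A') + 6 * ?p\<^sup>2 * (?A + ?A' + ?b) + 6 * ?q\<^sup>2 * (?A + ?A' + ?d)"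
      by (intro add_nonneg_nonneg mult_nonneg_nonneg) auto
    then show ?thesis by (simp add: algebra_simps)
  qed
  finally show ?thesis .
qed


section \<open>Asymptotic normality\<close>

theorem theorem1:
  fixes M :: "'a measure"
    and evl :: "'h::{real_inner,banach} \<Rightarrow> 'x::{real_inner,banach,second_countable_topology} \<Rightarrow> real"
    and K :: "'x \<Rightarrow> 'x \<Rightarrow> real"
    and X :: "'a \<Rightarrow> 'x"
    and Y :: "'a \<Rightarrow> 'y::{real_inner,banach,second_countable_topology}"
    and Xs :: "nat \<Rightarrow> 'a \<Rightarrow> 'x"
    and Ys :: "nat \<Rightarrow> 'a \<Rightarrow> 'y"
    and w :: "real \<Rightarrow> nat \<Rightarrow> nat \<Rightarrow> real"
    and wlim :: "real \<Rightarrow> real"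
    and \<gamma> :: real
  defines "k \<equiv> kernel_section evl K"
  defines "U \<equiv> (\<lambda>\<omega>. kcmd_U M k X Y (Xs 1 \<omega>) (Ys 1 \<omega>))"
    and "V \<equiv> (\<lambda>\<omega>. kcmd_V M k X Y (Xs 1 \<omega>) (Ys 1 \<omega>))"
  assumes prob: "prob_space M"
    and rkhs: "is_rkhs evl K"
    and K_meas: "(\<lambda>(x, y). K x y) \<in> borel_measurable (borel \<Otimes>\<^sub>M borel)"
    and X_rv: "X \<in> borel_measurable M"
    and Y_rv: "Y \<in> borel_measurable M"
    and Y_sq: "integrable M (\<lambda>\<omega>. (norm (Y \<omega>))\<^sup>2)"
    and sample_indep:
      "prob_space.indep_vars M (\<lambda>_. borel \<Otimes>\<^sub>M borel) (\<lambda>i \<omega>. (Xs i \<omega>, Ys i \<omega>)) {1..}"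
    and sample_distr:
      "\<And>i. i \<ge> 1 \<Longrightarrow> distr M (borel \<Otimes>\<^sub>M borel) (\<lambda>\<omega>. (Xs i \<omega>, Ys i \<omega>))
                  = distr M (borel \<Otimes>\<^sub>M borel) (\<lambda>\<omega>. (X \<omega>, Y \<omega>))"
    and w_pos: "\<And>\<delta> n i. \<delta> \<in> {0<..<1} \<Longrightarrow> 1 \<le> i \<Longrightarrow> i \<le> n \<Longrightarrow> w \<delta> n i > 0"
    and K_bdd: "bdd_above (range (\<lambda>(x, y). K x y))"
    and \<gamma>: "\<gamma> \<in> {0<..<1}"
    and w_mean: "\<exists>\<tau>>0. \<exists>n0::nat. \<forall>n>n0.
                   real n * \<bar>1 / real n * (\<Sum>i=1..n. w \<gamma> n i) - 1\<bar> \<le> \<tau>"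
    and w_max: "\<exists>C>0. \<forall>n\<ge>1. \<forall>\<delta>\<in>{0<..<1}. Max ((\<lambda>i. w \<delta> n i) ` {1..n}) < C"
    and w_lim: "\<And>\<delta>. \<delta> \<in> {0<..<1} \<Longrightarrow>
                   (\<lambda>n. 1 / real n * (\<Sum>i=1..n. (w \<delta> n i)\<^sup>2)) \<longlonglongrightarrow> (wlim \<delta>)\<^sup>2"
    and w_lim_gt: "\<And>\<delta>. \<delta> \<in> {0<..<1} \<Longrightarrow> (wlim \<delta>)\<^sup>2 > 1"
  shows "weak_conv_m
           (\<lambda>n. distr M borel (\<lambda>\<omega>. sqrt (real n) *
              (kcmd_estimator K (w \<gamma> n) n (\<lambda>i. Xs i \<omega>) (\<lambda>i. Ys i \<omega>) - KCMD M k X Y)))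
           (normal_law 0 (4 * prob_space.variance M U + 4 * (wlim \<gamma>)\<^sup>2 * prob_space.variance M V
                            - 8 * covariance M U V))"
proof -
  interpret prob_space M by (rule prob)

  define N :: "('x \<times> 'y) measure" where "N = borel \<Otimes>\<^sub>M borel"
  define D where "D = distr M N (\<lambda>\<omega>. (X \<omega>, Y \<omega>))"
  define S where "S i \<omega> = (Xs i \<omega>, Ys i \<omega>)" for i \<omega>
  have XY: "(\<lambda>\<omega>. (X \<omega>, Y \<omega>)) \<in> measurable M N"
    unfolding N_def using X_rv Y_rv by simp
  have sets_D: "sets D = sets N" by (simp add: D_def)
  have D_N: "borel_measurable D = (borel_measurable N :: ('x \<times> 'y \<Rightarrow> real) set)"
    by (rule measurable_cong_sets[OF sets_D refl])
  interpret sample: iid_sample M D S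
  proof
    have "measurable M D = measurable M N" by (rule measurable_cong_sets[OF refl sets_D])
    then show "indep_vars (\<lambda>_. D) S {1..}"
      using sample_indep unfolding indep_vars_def S_def[abs_def] N_def[symmetric] by (simp add: sets_D)
    show "distr M D (S i) = D" if "1 \<le> i" for i
    proof -
      have "distr M D (S i) = distr M N (S i)" by (rule distr_cong) (simp_all add: sets_D)
      also have "\<dots> = D"
        using sample_distr[OF that] unfolding D_def S_def[abs_def] N_def .
      finally show ?thesis .
    qed
  qed
  interpret D: prob_space D by (rule sample.prob_space_law)

  have K_inner: "K s t = k s \<bullet> k t" for s t
    unfolding k_def by (rule kernel_section_inner[OF rkhs])
  \<comment> \<open>\<open>K\<close> is only assumed bounded above, but its diagonal is \<open>norm (k x)\<^sup>2\<close>\<close>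
  obtain b where b: "\<And>s t. K s t \<le> b"
    using K_bdd unfolding bdd_above_def by auto
  define \<beta> where "\<beta> = sqrt b"
  have k_le: "norm (k x) \<le> \<beta>" for x
    unfolding norm_eq_sqrt_inner K_inner[symmetric] \<beta>_def using b by simp

  define \<Phi>\<^sub>X :: "'x \<times> 'y \<Rightarrow> 'h" where "\<Phi>\<^sub>X s = k (fst s)" for s
  define \<Phi>\<^sub>Y :: "'x \<times> 'y \<Rightarrow> 'y" where "\<Phi>\<^sub>Y s = snd s" for s
  define \<Phi>\<^sub>Z :: "'x \<times> 'y \<Rightarrow> ('y, 'h) hs" where "\<Phi>\<^sub>Z s = snd s \<otimes>\<^sub>H\<^sub>S k (fst s)" for s
  have K_meas': "(\<lambda>z. K (fst (fst z)) (fst (snd z))) \<in> borel_measurable (N \<Otimes>\<^sub>M N)"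
    using measurable_compose[of "\<lambda>z. (fst (fst z), fst (snd z))" "N \<Otimes>\<^sub>M N" "borel \<Otimes>\<^sub>M borel", OF _ K_meas]
    by (simp add: N_def)
  have Y_meas': "(\<lambda>z. snd (fst z) \<bullet> snd (snd z)) \<in> borel_measurable (N \<Otimes>\<^sub>M N)"
    unfolding N_def by measurable
  have featN: "measurable_feature N \<Phi>\<^sub>X" "measurable_feature N \<Phi>\<^sub>Y" "measurable_feature N \<Phi>\<^sub>Z"
    using K_meas' Y_meas'
    by (simp_all add: measurable_feature_def split_beta' \<Phi>\<^sub>X_def \<Phi>\<^sub>Y_def \<Phi>\<^sub>Z_def inner_tens_tens
        K_inner[symmetric])
  then have feat: "measurable_feature D \<Phi>\<^sub>X" "measurable_feature D \<Phi>\<^sub>Y" "measurable_feature D \<Phi>\<^sub>Z"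
    by (simp_all add: measurable_feature_cong_sets[OF sets_D])

  have Y2: "integrable D (\<lambda>s. (norm (\<Phi>\<^sub>Y s))\<^sup>2)"
    unfolding D_def \<Phi>\<^sub>Y_def by (subst integrable_distr_eq[OF XY]) (use Y_sq in \<open>simp_all add: N_def\<close>)
  have X2: "integrable D (\<lambda>s. (norm (\<Phi>\<^sub>X s))\<^sup>2)"
  proof (rule D.integrable_const_bound)
    show "AE s in D. norm ((norm (\<Phi>\<^sub>X s))\<^sup>2) \<le> \<beta>\<^sup>2"
      using k_le by (simp add: \<Phi>\<^sub>X_def power_mono)
  qed (use measurable_feature_norm[OF feat(1)] in simp)
  have Z2: "integrable D (\<lambda>s. (norm (\<Phi>\<^sub>Z s))\<^sup>2)"
  proof (rule Bochner_Integration.integrable_bound)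
    show "integrable D (\<lambda>s. \<beta>\<^sup>2 * (norm (\<Phi>\<^sub>Y s))\<^sup>2)" using Y2 by simp
    have "(norm (\<Phi>\<^sub>Z s))\<^sup>2 \<le> \<beta>\<^sup>2 * (norm (\<Phi>\<^sub>Y s))\<^sup>2" for s
      unfolding \<Phi>\<^sub>Z_def \<Phi>\<^sub>Y_def norm_tens power_mult_distrib
      by (subst mult.commute) (intro mult_right_mono power_mono k_le; simp)
    then show "AE s in D. norm ((norm (\<Phi>\<^sub>Z s))\<^sup>2) \<le> norm (\<beta>\<^sup>2 * (norm (\<Phi>\<^sub>Y s))\<^sup>2)" by simp
  qed (use measurable_feature_norm[OF feat(3)] in simp)

  define \<mu> where "\<mu> = (\<integral>\<omega>. Y \<omega> \<partial>M)"
  define m where "m = kernel_mean M k X"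
  define \<eta> where "\<eta> = kcmd_\<eta> M k X Y"
  define \<nu> where "\<nu> = \<mu> \<otimes>\<^sub>H\<^sub>S m"
  have \<nu>_eq: "kcmd_\<nu> M k X Y = \<nu>" by (simp add: kcmd_\<nu>_def \<nu>_def \<mu>_def m_def)

  have mean_exists: "has_hilbert_expectation D \<Phi> (hilbert_expectation M (\<lambda>\<omega>. \<Phi> (X \<omega>, Y \<omega>)))"
    if \<Phi>: "measurable_feature N \<Phi>" "integrable D (\<lambda>s. (norm (\<Phi> s))\<^sup>2)"
    for \<Phi> :: "'x \<times> 'y \<Rightarrow> 'f::{real_inner,banach}"
  proof -
    note inner = measurable_feature_inner[OF \<Phi>(1)] and nrm = measurable_feature_norm[OF \<Phi>(1)]
    have "integrable D (\<lambda>s. norm (\<Phi> s))"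
      by (rule D.square_integrable_imp_integrable[OF _ \<Phi>(2)]) (use nrm D_N in simp)
    then have "integrable M (\<lambda>\<omega>. norm (\<Phi> (X \<omega>, Y \<omega>)))"
      unfolding D_def by (subst (asm) integrable_distr_eq[OF XY nrm])
    then have "has_hilbert_expectation M (\<lambda>\<omega>. \<Phi> (X \<omega>, Y \<omega>)) (hilbert_expectation M (\<lambda>\<omega>. \<Phi> (X \<omega>, Y \<omega>)))"
      by (intro has_hilbert_expectation_hilbert_expectation measurable_compose[OF XY inner])
    then show ?thesis
      unfolding D_def by (subst has_hilbert_expectation_distr[OF XY inner])
  qed
  have Y_int: "integrable M Y"
  proof -
    have "integrable M (\<lambda>\<omega>. norm (Y \<omega>))"
      by (rule square_integrable_imp_integrable[OF _ Y_sq]) (use Y_rv in simp)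
    then show ?thesis using Y_rv integrable_norm_iff by blast
  qed
  have means: "has_hilbert_expectation D \<Phi>\<^sub>X m" "has_hilbert_expectation D \<Phi>\<^sub>Y \<mu>"
    "has_hilbert_expectation D \<Phi>\<^sub>Z \<eta>"
    using mean_exists[OF featN(1) X2] mean_exists[OF featN(2) Y2] mean_exists[OF featN(3) Z2]
    by (simp_all add: \<Phi>\<^sub>X_def[abs_def] \<Phi>\<^sub>Y_def[abs_def] \<Phi>\<^sub>Z_def[abs_def] m_def \<eta>_def \<mu>_def kernel_mean_def kcmd_\<eta>_def
        hilbert_expectation_eq_integral[OF Y_int])

  define \<Psi>\<^sub>X where "\<Psi>\<^sub>X s = \<Phi>\<^sub>X s - m" for s
  define \<Psi>\<^sub>Y where "\<Psi>\<^sub>Y s = \<Phi>\<^sub>Y s - \<mu>" for s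
  define \<Psi>\<^sub>Z where "\<Psi>\<^sub>Z s = \<Phi>\<^sub>Z s - \<eta>" for s
  have cfeat: "measurable_feature D \<Psi>\<^sub>X" "measurable_feature D \<Psi>\<^sub>Y" "measurable_feature D \<Psi>\<^sub>Z"
    unfolding \<Psi>\<^sub>X_def[abs_def] \<Psi>\<^sub>Y_def[abs_def] \<Psi>\<^sub>Z_def[abs_def]
    by (intro measurable_feature_diff_const feat)+
  have csq: "integrable D (\<lambda>s. (norm (\<Psi>\<^sub>X s))\<^sup>2)" "integrable D (\<lambda>s. (norm (\<Psi>\<^sub>Y s))\<^sup>2)"
    "integrable D (\<lambda>s. (norm (\<Psi>\<^sub>Z s))\<^sup>2)"
    unfolding \<Psi>\<^sub>X_def \<Psi>\<^sub>Y_def \<Psi>\<^sub>Z_def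
    by (intro square_integrable_diff_const D.prob_space_axioms feat X2 Y2 Z2)+
  have cmean: "has_hilbert_expectation D \<Psi>\<^sub>X 0" "has_hilbert_expectation D \<Psi>\<^sub>Y 0"
    "has_hilbert_expectation D \<Psi>\<^sub>Z 0"
    unfolding \<Psi>\<^sub>X_def[abs_def] \<Psi>\<^sub>Y_def[abs_def] \<Psi>\<^sub>Z_def[abs_def]
    by (intro has_hilbert_expectation_centred D.prob_space_axioms means)+

  \<comment> \<open>\<open>u\<close> and \<open>v\<close> are the functions \<open>kcmd_U\<close> and \<open>kcmd_V\<close>, in a form linear in the centred features\<close>
  define u where "u s = \<Psi>\<^sub>Z s \<bullet> \<eta> + (\<Psi>\<^sub>Y s \<otimes>\<^sub>H\<^sub>S m + \<mu> \<otimes>\<^sub>H\<^sub>S \<Psi>\<^sub>X s) \<bullet> (\<nu> - \<eta>)" for s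
  define v where "v s = \<Psi>\<^sub>Z s \<bullet> \<nu>" for s
  have U_eq: "U = (\<lambda>\<omega>. u (S 1 \<omega>))"
    unfolding U_def kcmd_U_def u_def Let_def \<nu>_eq \<eta>_def[symmetric] \<mu>_def[symmetric] m_def[symmetric]
      \<Psi>\<^sub>X_def \<Psi>\<^sub>Y_def \<Psi>\<^sub>Z_def \<Phi>\<^sub>X_def \<Phi>\<^sub>Y_def \<Phi>\<^sub>Z_def S_def
    by (simp add: \<nu>_def tens.diff_left tens.diff_right scaleR_2 algebra_simps)
  have V_eq: "V = (\<lambda>\<omega>. v (S 1 \<omega>))"
    unfolding V_def kcmd_V_def v_def \<nu>_eq \<eta>_def[symmetric] \<Psi>\<^sub>Z_def \<Phi>\<^sub>Z_def S_def by simp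

  \<comment> \<open>\<open>y \<mapsto> \<langle>y \<otimes> m, \<nu> - \<eta>\<rangle>\<close> is a bounded functional, so \<open>u\<close> is a sum of three centred features
    tested against fixed vectors\<close>
  obtain z where z: "\<And>y. (y \<otimes>\<^sub>H\<^sub>S m) \<bullet> (\<nu> - \<eta>) = z \<bullet> y"
    using riesz_representation[OF bounded_linear_compose[OF bounded_linear_inner_left tens.bounded_linear_left]]
    by blast
  define z' where "z' = blinfun_apply (hs_op (\<nu> - \<eta>)) \<mu>"
  have u_alt: "u s = \<Psi>\<^sub>Z s \<bullet> \<eta> + (\<Psi>\<^sub>Y s \<bullet> z + \<Psi>\<^sub>X s \<bullet> z')" for s
    unfolding u_def inner_add_left z inner_tens_left[of \<mu>] z'_def by (simp add: inner_commute)
  note cinner = measurable_feature_inner[OF cfeat(1)] measurable_feature_inner[OF cfeat(2)]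
    measurable_feature_inner[OF cfeat(3)]
  note csq_inner = square_integrable_feature_inner[OF cfeat(1) csq(1)]
    square_integrable_feature_inner[OF cfeat(2) csq(2)] square_integrable_feature_inner[OF cfeat(3) csq(3)]
  have u: "u \<in> borel_measurable D" "integrable D (\<lambda>s. (u s)\<^sup>2)" "(\<integral>s. u s \<partial>D) = 0"
  proof -
    show "u \<in> borel_measurable D" unfolding u_alt[abs_def] by (intro borel_measurable_add cinner)
    show "integrable D (\<lambda>s. (u s)\<^sup>2)"
      unfolding u_alt by (intro square_integrable_add borel_measurable_add cinner csq_inner)
    show "(\<integral>s. u s \<partial>D) = 0"
      unfolding u_alt using cmean by (simp add: has_hilbert_expectation_def)
  qed
  have v: "v \<in> borel_measurable D" "integrable D (\<lambda>s. (v s)\<^sup>2)" "(\<integral>s. v s \<partial>D) = 0"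
    unfolding v_def[abs_def] using cinner(3) csq_inner(3) cmean(3)
    by (simp_all add: has_hilbert_expectation_def)
  have uv: "integrable D (\<lambda>s. u s * v s)" by (rule square_integrable_mult[OF u(1,2) v(1,2)])
  have u_int: "integrable D u" and v_int: "integrable D v"
    using D.square_integrable_imp_integrable u v by blast+
  define Su where "Su = (\<integral>s. (u s)\<^sup>2 \<partial>D)"
  define Sv where "Sv = (\<integral>s. (v s)\<^sup>2 \<partial>D)"
  define Suv where "Suv = (\<integral>s. u s * v s \<partial>D)"
  have EU: "expectation U = 0" "expectation V = 0"
    unfolding U_eq V_eq using sample.integral_sample[of 1 u] sample.integral_sample[of 1 v] u v by simp_all
  have varU: "variance U = Su"
    unfolding EU unfolding U_eq Su_def using sample.integral_sample[of 1 "\<lambda>s. (u s)\<^sup>2"] u(1) by simp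
  have varV: "variance V = Sv"
    unfolding EU unfolding V_eq Sv_def using sample.integral_sample[of 1 "\<lambda>s. (v s)\<^sup>2"] v(1) by simp
  have covUV: "covariance M U V = Suv"
    unfolding covariance_def EU unfolding U_eq V_eq Suv_def
    using sample.integral_sample[of 1 "\<lambda>s. u s * v s"] u(1) v(1) by simp

  obtain C where C: "0 < C" "\<And>n. 1 \<le> n \<Longrightarrow> Max ((\<lambda>i. w \<gamma> n i) ` {1..n}) < C"
    using w_max \<gamma> by blast
  have w_bounds: "0 \<le> w \<gamma> n i" "w \<gamma> n i \<le> C" if "1 \<le> i" "i \<le> n" for n i
  proof -
    show "0 \<le> w \<gamma> n i" using w_pos[OF \<gamma> that] by simp
    have "w \<gamma> n i \<le> Max ((\<lambda>i. w \<gamma> n i) ` {1..n})" using that by (intro Max_ge) auto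
    also have "\<dots> < C" using that by (intro C(2)) simp
    finally show "w \<gamma> n i \<le> C" by (rule less_imp_le)
  qed
  define \<delta> where "\<delta> n = 1 / real n * (\<Sum>i=1..n. w \<gamma> n i) - 1" for n :: nat
  define q where "q n = 1 / real n * (\<Sum>i=1..n. (w \<gamma> n i)\<^sup>2)" for n :: nat
  have q: "q \<longlonglongrightarrow> (wlim \<gamma>)\<^sup>2" using w_lim[OF \<gamma>] by (simp add: q_def[abs_def])
  have \<delta>: "(\<lambda>n. sqrt (real n) * \<delta> n) \<longlonglongrightarrow> 0" "\<delta> \<longlonglongrightarrow> 0"
  proof -
    obtain \<tau> n0 where \<tau>: "0 < \<tau>" "\<And>n. n0 < n \<Longrightarrow> real n * \<bar>\<delta> n\<bar> \<le> \<tau>"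
      using w_mean unfolding \<delta>_def by blast
    have bound: "\<bar>\<delta> n\<bar> \<le> \<tau> / real n" if "n0 < n" for n
      using \<tau>(2)[OF that] that by (simp add: field_simps)
    have ev: "\<forall>\<^sub>F n in sequentially. n0 < n" by (rule eventually_gt_at_top)
    show "\<delta> \<longlonglongrightarrow> 0"
      by (rule Lim_null_comparison[OF _ lim_const_over_n[of \<tau>]])
         (use eventually_mono[OF ev bound] in simp)
    have lim: "(\<lambda>n. sqrt (real n) * (\<tau> / real n)) \<longlonglongrightarrow> 0" by real_asymp
    have "norm (sqrt (real n) * \<delta> n) \<le> sqrt (real n) * (\<tau> / real n)" if "n0 < n" for n
      unfolding real_norm_def abs_mult real_sqrt_abs2 using bound[OF that] by (intro mult_mono) auto
    from eventually_mono[OF ev this] show "(\<lambda>n. sqrt (real n) * \<delta> n) \<longlonglongrightarrow> 0"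
      by (rule Lim_null_comparison[OF _ lim])
  qed

  \<comment> \<open>deviations of the empirical means, and of the weighted one, from the true means; the identities
    \<open>avg_X\<close>, \<open>avg_Y\<close>, \<open>avg_Z\<close>, \<open>avg_W\<close> below state this for \<open>n > 0\<close>\<close>
  define fluct_X where "fluct_X n \<omega> = (\<Sum>i=1..n. (1 / real n) *\<^sub>R \<Psi>\<^sub>X (S i \<omega>))" for n \<omega>
  define fluct_Y where "fluct_Y n \<omega> = (\<Sum>i=1..n. (1 / real n) *\<^sub>R \<Psi>\<^sub>Y (S i \<omega>))" for n \<omega>
  define fluct_Z where "fluct_Z n \<omega> = (\<Sum>i=1..n. (1 / real n) *\<^sub>R \<Psi>\<^sub>Z (S i \<omega>))" for n \<omega>
  define fluct_W where "fluct_W n \<omega> = (\<Sum>i=1..n. (w \<gamma> n i / real n) *\<^sub>R \<Psi>\<^sub>Z (S i \<omega>))" for n \<omega>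
  define T where "T n \<omega> = sqrt (real n) *
      (kcmd_estimator K (w \<gamma> n) n (\<lambda>i. Xs i \<omega>) (\<lambda>i. Ys i \<omega>) - KCMD M k X Y)" for n \<omega>
  define f where "f n i s = 2 * u s - 2 * w \<gamma> n i * v s" for n i s
  \<comment> \<open>the constant of \<open>linearisation_error\<close>, where \<open>\<beta> + norm m\<close> bounds \<open>fluct_X\<close>\<close>
  define c where "c = 1 + norm (\<nu> - \<eta>) + 6 * (norm m + (\<beta> + norm m))\<^sup>2 + 6 * (norm \<mu>)\<^sup>2"
  define r where "r n \<omega> = sqrt (real n) * (c * ((norm (fluct_Z n \<omega>))\<^sup>2 + (norm (fluct_W n \<omega>))\<^sup>2
        + (norm (fluct_X n \<omega>))\<^sup>2 + (norm (fluct_Y n \<omega>))\<^sup>2)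
      + (\<delta> n)\<^sup>2 * (norm \<eta>)\<^sup>2 + 2 * \<bar>\<delta> n\<bar> * \<bar>\<eta> \<bullet> \<nu>\<bar>)" for n \<omega>

  have approx: "\<bar>T n \<omega> - (\<Sum>i=1..n. f n i (S i \<omega>)) / sqrt (real n)\<bar> \<le> r n \<omega>" for n \<omega>
  proof (cases "n = 0")
    case True
    then show ?thesis by (simp add: T_def r_def)
  next
    case False
    then have n: "0 < real n" by simp
    have const: "(\<Sum>i=1..n. (1 / real n) *\<^sub>R a) = a" for a :: "'b::real_vector"
      using n by (simp add: sum_constant_scaleR)
    have avg_X: "(\<Sum>i=1..n. (1 / real n) *\<^sub>R k (Xs i \<omega>)) = m + fluct_X n \<omega>"
      unfolding fluct_X_def \<Psi>\<^sub>X_def \<Phi>\<^sub>X_def S_def scaleR_diff_right sum_subtractf const by simp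
    have avg_Y: "(\<Sum>i=1..n. (1 / real n) *\<^sub>R Ys i \<omega>) = \<mu> + fluct_Y n \<omega>"
      unfolding fluct_Y_def \<Psi>\<^sub>Y_def \<Phi>\<^sub>Y_def S_def scaleR_diff_right sum_subtractf const by simp
    have avg_Z: "(\<Sum>i=1..n. (1 / real n) *\<^sub>R (Ys i \<omega> \<otimes>\<^sub>H\<^sub>S k (Xs i \<omega>))) = \<eta> + fluct_Z n \<omega>"
      unfolding fluct_Z_def \<Psi>\<^sub>Z_def \<Phi>\<^sub>Z_def S_def scaleR_diff_right sum_subtractf const by simp
    have "(\<Sum>i=1..n. (w \<gamma> n i / real n) *\<^sub>R \<eta>) = (1 + \<delta> n) *\<^sub>R \<eta>"
      by (simp add: \<delta>_def scaleR_sum_left[symmetric] sum_divide_distrib)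
    then have avg_W: "(\<Sum>i=1..n. (w \<gamma> n i / real n) *\<^sub>R (Ys i \<omega> \<otimes>\<^sub>H\<^sub>S k (Xs i \<omega>)))
        = (1 + \<delta> n) *\<^sub>R \<eta> + fluct_W n \<omega>"
      unfolding fluct_W_def \<Psi>\<^sub>Z_def \<Phi>\<^sub>Z_def S_def scaleR_diff_right sum_subtractf by simp
    have "norm (m + fluct_X n \<omega>) \<le> (\<Sum>i=1..n. \<beta> / real n)"
      unfolding avg_X[symmetric] using n k_le by (intro sum_norm_le) (simp add: divide_right_mono)
    then have "norm (m + fluct_X n \<omega>) \<le> \<beta>" using n by simp
    then have X_le: "norm (fluct_X n \<omega>) \<le> \<beta> + norm m"
      using norm_triangle_ineq4[of "m + fluct_X n \<omega>" m] by simp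
    define lin where "lin = 2 * (fluct_Z n \<omega> \<bullet> \<eta>
          + (fluct_Y n \<omega> \<otimes>\<^sub>H\<^sub>S m + \<mu> \<otimes>\<^sub>H\<^sub>S fluct_X n \<omega>) \<bullet> (\<nu> - \<eta>)) - 2 * (fluct_W n \<omega> \<bullet> \<nu>)"
    \<comment> \<open>the first-order part is an average over the sample: this is where \<open>kcmd_U\<close> and \<open>kcmd_V\<close> come from\<close>
    have "lin = (\<Sum>i=1..n. f n i (S i \<omega>) / real n)"
      unfolding lin_def fluct_X_def fluct_Y_def fluct_Z_def fluct_W_def f_def u_def v_def
        tens.sum_left tens.sum_right tens.scaleR_left tens.scaleR_right inner_add_left inner_sum_left
        inner_scaleR_left
      by (simp add: sum_subtractf[symmetric] sum.distrib[symmetric] sum_distrib_left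
          diff_divide_distrib add_divide_distrib distrib_left mult.assoc)
    then have lin_eq: "(\<Sum>i=1..n. f n i (S i \<omega>)) / sqrt (real n) = sqrt (real n) * lin"
      using n by (simp add: sum_divide_distrib[symmetric] field_simps)
    have "\<bar>kcmd_estimator K (w \<gamma> n) n (\<lambda>i. Xs i \<omega>) (\<lambda>i. Ys i \<omega>) - KCMD M k X Y - lin\<bar>
        \<le> c * ((norm (fluct_Z n \<omega>))\<^sup>2 + (norm (fluct_W n \<omega>))\<^sup>2
            + (norm (fluct_X n \<omega>))\<^sup>2 + (norm (fluct_Y n \<omega>))\<^sup>2)
          + (\<delta> n)\<^sup>2 * (norm \<eta>)\<^sup>2 + 2 * \<bar>\<delta> n\<bar> * \<bar>\<eta> \<bullet> \<nu>\<bar>"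
      unfolding kcmd_estimator_eq_norms[of K k, OF K_inner] avg_X avg_Y avg_Z avg_W KCMD_def
        \<eta>_def[symmetric] \<nu>_eq lin_def c_def
      using linearisation_error[OF X_le, of \<eta> "fluct_Z n \<omega>" \<mu> "fluct_Y n \<omega>" m "\<delta> n" "fluct_W n \<omega>",
          folded \<nu>_def] .
    then have "sqrt (real n) * \<bar>kcmd_estimator K (w \<gamma> n) n (\<lambda>i. Xs i \<omega>) (\<lambda>i. Ys i \<omega>) - KCMD M k X Y - lin\<bar>
        \<le> r n \<omega>"
      unfolding r_def by (rule mult_left_mono) simp
    then show ?thesis
      unfolding T_def lin_eq right_diff_distrib[symmetric] abs_mult by simp
  qed

  define ZZ where "ZZ = (\<integral>s. (norm (\<Psi>\<^sub>Z s))\<^sup>2 \<partial>D)"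
  define XX where "XX = (\<integral>s. (norm (\<Psi>\<^sub>X s))\<^sup>2 \<partial>D)"
  define YY where "YY = (\<integral>s. (norm (\<Psi>\<^sub>Y s))\<^sup>2 \<partial>D)"
  note second_moment = sample.weighted_sum_second_moment[OF cfeat(1) csq(1) cmean(1)]
    sample.weighted_sum_second_moment[OF cfeat(2) csq(2) cmean(2)]
    sample.weighted_sum_second_moment[OF cfeat(3) csq(3) cmean(3)]
  have r_int: "integrable M (r n)" for n
    unfolding r_def[abs_def] fluct_X_def fluct_Y_def fluct_Z_def fluct_W_def
    by (intro integrable_mult_right Bochner_Integration.integrable_add integrable_const second_moment) auto
  \<comment> \<open>each fluctuation has second moment of order \<open>1 / n\<close>, and \<open>sqrt n * \<delta> n\<close> is of order \<open>1 / sqrt n\<close>\<close>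
  have r_mean: "(\<integral>\<omega>. r n \<omega> \<partial>M) = c * (XX + YY + ZZ + q n * ZZ) / sqrt (real n)
      + sqrt (real n) * \<delta> n * \<delta> n * (norm \<eta>)\<^sup>2 + 2 * \<bar>sqrt (real n) * \<delta> n\<bar> * \<bar>\<eta> \<bullet> \<nu>\<bar>" for n
  proof (cases "n = 0")
    case True
    then show ?thesis by (simp add: r_def)
  next
    case False
    then have n: "0 < real n" by simp
    have 1: "(\<Sum>i=1..n. (1 / real n)\<^sup>2) = 1 / real n"
      using n by (simp add: power2_eq_square)
    have 2: "(\<Sum>i=1..n. (w \<gamma> n i / real n)\<^sup>2) = q n / real n"
      by (simp add: q_def power_divide sum_divide_distrib[symmetric] power2_eq_square)
    have sub: "finite {1..n}" "{1..n} \<subseteq> {1..}" by auto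
    have int: "integrable M (\<lambda>\<omega>. (norm (fluct_X n \<omega>))\<^sup>2)" "integrable M (\<lambda>\<omega>. (norm (fluct_Y n \<omega>))\<^sup>2)"
      "integrable M (\<lambda>\<omega>. (norm (fluct_Z n \<omega>))\<^sup>2)" "integrable M (\<lambda>\<omega>. (norm (fluct_W n \<omega>))\<^sup>2)"
      unfolding fluct_X_def fluct_Y_def fluct_Z_def fluct_W_def by (intro second_moment sub)+
    have E: "(\<integral>\<omega>. (norm (fluct_X n \<omega>))\<^sup>2 \<partial>M) = 1 / real n * XX"
      "(\<integral>\<omega>. (norm (fluct_Y n \<omega>))\<^sup>2 \<partial>M) = 1 / real n * YY"
      "(\<integral>\<omega>. (norm (fluct_Z n \<omega>))\<^sup>2 \<partial>M) = 1 / real n * ZZ"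
      "(\<integral>\<omega>. (norm (fluct_W n \<omega>))\<^sup>2 \<partial>M) = q n / real n * ZZ"
      unfolding fluct_X_def fluct_Y_def fluct_Z_def fluct_W_def XX_def YY_def ZZ_def
      by (simp_all only: second_moment(2,4,6)[OF sub] 1 2)
    have "(\<integral>\<omega>. r n \<omega> \<partial>M) = sqrt (real n) * (c * (1 / real n * ZZ + q n / real n * ZZ + 1 / real n * XX
        + 1 / real n * YY) + (\<delta> n)\<^sup>2 * (norm \<eta>)\<^sup>2 + 2 * \<bar>\<delta> n\<bar> * \<bar>\<eta> \<bullet> \<nu>\<bar>)"
      unfolding r_def E[symmetric] using int by (simp add: prob_space)
    also have "\<dots> = c * (XX + YY + ZZ + q n * ZZ) * (sqrt (real n) / real n)
      + sqrt (real n) * \<delta> n * \<delta> n * (norm \<eta>)\<^sup>2 + 2 * \<bar>sqrt (real n) * \<delta> n\<bar> * \<bar>\<eta> \<bullet> \<nu>\<bar>"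
      by (simp add: abs_mult power2_eq_square add_divide_distrib algebra_simps)
    also have "sqrt (real n) / real n = 1 / sqrt (real n)"
      using n by (simp add: field_simps)
    finally show ?thesis by simp
  qed
  have r_lim: "(\<lambda>n. \<integral>\<omega>. r n \<omega> \<partial>M) \<longlonglongrightarrow> 0"
  proof -
    have inv: "(\<lambda>n. 1 / sqrt (real n)) \<longlonglongrightarrow> 0" by real_asymp
    have "(\<lambda>n. c * (XX + YY + ZZ + q n * ZZ) * (1 / sqrt (real n))
        + sqrt (real n) * \<delta> n * \<delta> n * (norm \<eta>)\<^sup>2 + 2 * \<bar>sqrt (real n) * \<delta> n\<bar> * \<bar>\<eta> \<bullet> \<nu>\<bar>)
      \<longlonglongrightarrow> c * (XX + YY + ZZ + (wlim \<gamma>)\<^sup>2 * ZZ) * 0 + 0 * 0 * (norm \<eta>)\<^sup>2 + 2 * \<bar>0\<bar> * \<bar>\<eta> \<bullet> \<nu>\<bar>"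
      by (intro tendsto_intros inv q \<delta>)
    then show ?thesis unfolding r_mean by simp
  qed

  have T_rv: "T n \<in> borel_measurable M" for n
  proof -
    have S: "(\<lambda>\<omega>. (Xs i \<omega>, Ys i \<omega>)) \<in> measurable M (borel \<Otimes>\<^sub>M borel)" if "1 \<le> i" for i
      using sample_indep that unfolding indep_vars_def by auto
    have X: "Xs i \<in> borel_measurable M" if "1 \<le> i" for i
      using measurable_compose[OF S[OF that] measurable_fst] by simp
    have Y: "Ys i \<in> borel_measurable M" if "1 \<le> i" for i
      using measurable_compose[OF S[OF that] measurable_snd] by simp
    have KX: "(\<lambda>\<omega>. K (Xs i \<omega>) (Xs j \<omega>)) \<in> borel_measurable M" if "1 \<le> i" "1 \<le> j" for i j
      using measurable_compose[OF measurable_Pair[OF X[OF that(1)] X[OF that(2)]] K_meas] by simp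
    have YY: "(\<lambda>\<omega>. Ys i \<omega> \<bullet> Ys j \<omega>) \<in> borel_measurable M" if "1 \<le> i" "1 \<le> j" for i j
      using X Y that by simp
    show ?thesis
      unfolding T_def[abs_def] kcmd_estimator_def
      by (intro borel_measurable_times borel_measurable_diff borel_measurable_add borel_measurable_const
          borel_measurable_sum KX YY) auto
  qed

  have var_lim: "(\<lambda>n. (\<Sum>i=1..n. \<integral>s. (f n i s)\<^sup>2 \<partial>D) / real n)
      \<longlonglongrightarrow> 4 * Su + 4 * (wlim \<gamma>)\<^sup>2 * Sv - 8 * Suv"
  proof -
    have f2: "(\<integral>s. (f n i s)\<^sup>2 \<partial>D) = 4 * Su - 8 * w \<gamma> n i * Suv + 4 * (w \<gamma> n i)\<^sup>2 * Sv" for n i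
    proof -
      have "(f n i s)\<^sup>2 = 4 * (u s)\<^sup>2 - 8 * w \<gamma> n i * (u s * v s) + 4 * (w \<gamma> n i)\<^sup>2 * (v s)\<^sup>2" for s
        by (simp add: f_def power2_eq_square algebra_simps)
      then show ?thesis
        using u(2) v(2) uv by (simp add: Su_def Sv_def Suv_def)
    qed
    have "(\<Sum>i=1..n. \<integral>s. (f n i s)\<^sup>2 \<partial>D) / real n = 4 * Su - 8 * (1 + \<delta> n) * Suv + 4 * q n * Sv"
      if "1 \<le> n" for n
      using that unfolding f2 \<delta>_def q_def
      by (simp add: sum.distrib sum_subtractf sum_distrib_left[symmetric] sum_distrib_right[symmetric]
          add_divide_distrib diff_divide_distrib)
    then have ev: "\<forall>\<^sub>F n in sequentially. 4 * Su - 8 * (1 + \<delta> n) * Suv + 4 * q n * Sv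
        = (\<Sum>i=1..n. \<integral>s. (f n i s)\<^sup>2 \<partial>D) / real n"
      by (intro eventually_sequentiallyI[of 1]) simp
    have "(\<lambda>n. 4 * Su - 8 * (1 + \<delta> n) * Suv + 4 * q n * Sv)
        \<longlonglongrightarrow> 4 * Su - 8 * (1 + 0) * Suv + 4 * (wlim \<gamma>)\<^sup>2 * Sv"
      by (intro tendsto_intros \<delta> q)
    then show ?thesis
      using Lim_transform_eventually[OF _ ev] by (simp add: algebra_simps)
  qed

  have "weak_conv_m (\<lambda>n. distr M borel (T n)) (normal_law 0 (4 * Su + 4 * (wlim \<gamma>)\<^sup>2 * Sv - 8 * Suv))"
  proof (rule sample.dominated_array_clt[where f=f and r=r and G="\<lambda>s. 2 * \<bar>u s\<bar> + 2 * C * \<bar>v s\<bar>"])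
    show "f n i \<in> borel_measurable D" for n i
      unfolding f_def[abs_def] using u(1) v(1) by simp
    show "(\<lambda>s. 2 * \<bar>u s\<bar> + 2 * C * \<bar>v s\<bar>) \<in> borel_measurable D"
      using u(1) v(1) by simp
    show "integrable D (\<lambda>s. (2 * \<bar>u s\<bar> + 2 * C * \<bar>v s\<bar>)\<^sup>2)"
      using u v by (intro square_integrable_add) (simp_all add: power_mult_distrib)
    show "(\<integral>s. f n i s \<partial>D) = 0" for n i
      unfolding f_def using u_int v_int u(3) v(3) by simp
    show "\<bar>f n i s\<bar> \<le> 2 * \<bar>u s\<bar> + 2 * C * \<bar>v s\<bar>" if "1 \<le> i" "i \<le> n" for n i s
    proof -
      have "\<bar>f n i s\<bar> \<le> 2 * \<bar>u s\<bar> + 2 * (w \<gamma> n i * \<bar>v s\<bar>)"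
        using abs_triangle_ineq4[of "2 * u s" "2 * w \<gamma> n i * v s"] w_bounds(1)[OF that]
        by (simp add: f_def abs_mult)
      moreover have "w \<gamma> n i * \<bar>v s\<bar> \<le> C * \<bar>v s\<bar>"
        by (intro mult_right_mono w_bounds that) simp
      ultimately show ?thesis by simp
    qed
  qed (fact var_lim T_rv r_int r_lim approx)+
  then show ?thesis
    unfolding varU varV covUV T_def[abs_def] .
qed

end
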